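(* Assume the hypotheses on $f$, $G$ and $h$ listed in the context, let $\beta$ and $\delta_G$ be the constants described in the context, and assume that $$\alpha=\beta-\delta_G>0\qquad\text{and}\qquad \int_{-\infty}^te^{\alpha s}\|h(s)\|^2\,ds<+\infty\quad\text{for all }t\in\mathbb R.$$ Let $\{U(t,\tau)\}_{t\ge\tau}$ be the process on $\mathcal H_c$ generated by the problem $$u_{tt}-\Delta u_t+\Delta^2u+\lambda u+f(u)=G(t,u^t)+h(x,t)\ \text{ in }\Omega,\ t>\tau,\qquad u=\Delta u=0\ \text{ on }\partial\Omega,\ t>\tau,$$ $$u(x,\tau+\theta)=\phi_0(x,\theta),\quad u_t(x,\tau+\theta)=\phi_1(x,\theta),\qquad x\in\Omega,\ \theta\in[-r,0].$$ Then, for some constant $C>0$, the family $\widehat D_0=\{D_0(t):t\in\mathbb R\}$ defined by $D_0(t)=B_{\mathcal H_c}(0,\rho(t))$, the ball in $\mathcal H_c$ centred at $0$ with radius $\rho(t)$ given by $$\rho^2(t)=C\left(1+e^{-\alpha(t-r)}\int_{-\infty}^te^{\alpha s}\|h(s)\|^2\,ds\right),$$ is a pullback $\mathcal D_\alpha$-absorbing family for $\{U(t,\tau)\}_{t\ge\tau}$ on $\mathcal H_c$: for any $t\in\mathbb R$ and any $\widehat D\in\mathcal D_\alpha$ there exists $\tau_0=\tau_0(t,\widehat D)\le t$ such that $U(t,\tau)D(\tau)\subset D_0(t)$ for all $\tau\le\tau_0$. Moreover, $\widehat D_0\in\mathcal D_\alpha$.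
   Context: **Setting.** $\Omega\subset\mathbb R^N$ ($N\ge1$) is a bounded domain with smooth boundary, $\lambda>0$, $r>0$. $H=L^2(\Omega)$ with norm $\|\cdot\|$ and inner product $(\cdot,\cdot)$; $V=H^2(\Omega)\cap H_0^1(\Omega)$, on which $\|\Delta\cdot\|$ is equivalent to the standard norm; $V'$ is the dual of $V$. For a Banach space $X$, $C_X=C([-r,0];X)$ with the sup norm. For a function $u$ of time, the history is $u^t(\theta)=u(t+\theta)$, $\theta\in[-r,0]$, while $u_t$ is the time derivative; $(u_t)^t(\theta)=u_t(t+\theta)$. The compatible history space is $$\mathcal H_c=\{(\phi_0,\phi_1)\in C_V\times C_H:\ \phi_0\in C^1([-r,0];H),\ \partial_\theta\phi_0=\phi_1\text{ in }C_H\},$$ with the norm of $\mathcal H=C_V\times C_H$. **Hypotheses on $f$.** $f\in C^1(\mathbb R,\mathbb R)$, $f(0)=0$, $F(s)=\int_0^sf(\xi)\,d\xi$. There is $C_f>0$ with $F(s)\ge-C_f-\frac\lambda4s^2$ for all $s\in\mathbb R$, and there are $\mu_0,\delta_0,C_0>0$, with $\delta_0$ sufficiently small, such that $f(s)s\ge\mu_0F(s)-\delta_0s^2-C_0$ for all $s\in\mathbb R$. Growth: if $N>4$, there is $C>0$ with $|f(s)|\le C(1+|s|^\rho)$, $1\le\rho\le\frac N{N-4}$ (this exponent is unrelated to the radius $\rho(t)$ in the claim); if $1\le N\le4$, $f$ has any finite polynomial growth. Local Lipschitz: for every $R>0$ there is $L_R>0$ with $\|f(u)-f(v)\|\le L_R\|u-v\|_V$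 whenever $\|u\|_V+\|v\|_V\le R$. **Hypotheses on $G:\mathbb R\times C_H\to H$.** (G1) $t\mapsto G(t,\xi)$ is measurable for every $\xi\in C_H$. (G2) $G(t,0)=0$ for all $t\in\mathbb R$. (G3) There is $L_G>0$ with $\|G(t,\xi)-G(t,\eta)\|\le L_G\|\xi-\eta\|_{C_H}$ for all $t\in\mathbb R$, $\xi,\eta\in C_H$. (G4) There are $m_0>0$, $C_1>0$ such that for every $m\in[0,m_0]$ (and all $\tau\le t$, $u,v\in C([\tau-r,t];H)$), $\int_\tau^te^{ms}\|G(s,u^s)-G(s,v^s)\|^2ds\le C_1\int_{\tau-r}^te^{ms}\|u(s)-v(s)\|^2ds$. **Hypothesis on $h$.** $h\in L^2_{\rm loc}(\mathbb R;H)$. **Weak solution.** $u$ is a weak solution on $[\tau-r,T]$ with initial history $(\phi_0,\phi_1)\in\mathcal H_c$ if $u(t)=\phi_0(t-\tau)$ and $u_t(t)=\phi_1(t-\tau)$ for $t\in[\tau-r,\tau]$; $u\in L^\infty(\tau,T;V)$, $u_t\in L^\infty(\tau,T;H)\cap L^2(\tau,T;H_0^1(\Omega))$, $u_{tt}\in L^2(\tau,T;V')$; and for every $\varphi\in V$ and a.e. $t\in(\tau,T)$, $$(u_{tt}(t),\varphi)+(\nabla u_t(t),\nabla\varphi)+(\Delta u(t),\Delta\varphi)+\lambda(u(t),\varphi)+(f(u(t)),\varphi)=(G(t,u^t),\varphi)+(h(t),\varphi),$$ the first term being understood as the $V'$–$V$ pairing. For each $\tau$, each $T>\tau$ and each datum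 in $\mathcal H_c$ there is a unique weak solution; it satisfies $u\in C([\tau-r,T];V)$, $u_t\in C([\tau-r,T];H)$, and $(u^t,(u_t)^t)\in\mathcal H_c$ for all $t\in[\tau,T]$. **Process.** $U(t,\tau):\mathcal H_c\to\mathcal H_c$, $U(t,\tau)(\phi_0,\phi_1)=(u^t,(u_t)^t)$ for $t\ge\tau$, where $u$ is the unique weak solution with initial history $(\phi_0,\phi_1)$ at time $\tau$. **The constants $\beta$ and $\delta_G$.** For a weak solution $u$ put $$\mathcal L(t)=\|u_t\|^2+\|\Delta u\|^2+\lambda\|u\|^2+2\int_\Omega F(u)\,dx+\varepsilon\bigl(2(u_t,u)+\|\nabla u\|^2\bigr)+K_0,$$ where $0<\varepsilon<1$ is sufficiently small and $K_0>0$ is chosen large enough, so that for constants $C_5,C_6>0$ independent of $t$, $C_5(\|u_t\|^2+\|\Delta u\|^2)\le\mathcal L(t)\le C_6(1+\|u_t\|^2+\|\Delta u\|^2+\int_\Omega F(u)\,dx)$. The number $\beta>0$ is the dissipation rate obtained from the modified energy estimate, i.e. the constant in $$\frac{d}{dt}\mathcal L(t)+\beta\mathcal L(t)\le C\|G(t,u^t)\|^2+C\|h(t)\|^2+C .$$ The number $\delta_G>0$ is the constant generated by estimating the delay term through (G4), i.e. the constant in the resulting inequality $$\mathcal L(t)e^{\beta t}\le Ce^{\beta\tau}\bigl(1+\|\phi_0\|_{C_V}^2+\|\phi_1\|_{C_H}^2\bigr)+\delta_G\int_\tau^te^{\beta s}\mathcal L(s)\,ds+C\int_\tau^te^{\beta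 s}\|h(s)\|^2ds+C\int_\tau^te^{\beta s}ds ;$$ it depends only on $C_1$, domain-related constants and the equivalence constants $C_5,C_6$, and is independent of $t$, $\tau$ and the particular solution. **Tempered class.** For $\alpha>0$, $\mathcal D_\alpha$ is the class of all families $\widehat D=\{D(t):t\in\mathbb R\}$ of nonempty subsets of $\mathcal H_c$ with $\lim_{\tau\to-\infty}e^{\alpha\tau}\sup_{\xi\in D(\tau)}\|\xi\|_{\mathcal H_c}^2=0$. *)

theory Defs
  imports "HOL-Analysis.Analysis" "HOL-Library.FuncSet"
begin

section \<open>The Hilbert space of square-integrable functions modulo equality a.e.\<close>

definition square_integrable :: "('a::euclidean_space \<Rightarrow> real) \<Rightarrow> bool" where
  "square_integrable f \<longleftrightarrow>
     f \<in> borel_measurable lebesgue \<and> integrable lebesgue (\<lambda>x. (f x)\<^sup>2)"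

lemma square_integrable_0: "square_integrable (\<lambda>x. 0)"
  by (simp add: square_integrable_def)

lemma square_integrable_scale: "square_integrable f \<Longrightarrow> square_integrable (\<lambda>x. c * f x)"
  by (auto simp: square_integrable_def power_mult_distrib intro!: borel_measurable_times)

lemma square_integrable_mult:
  assumes "square_integrable f" "square_integrable g"
  shows "integrable lebesgue (\<lambda>x. f x * g x)"
proof (rule Bochner_Integration.integrable_bound)
  show "integrable lebesgue (\<lambda>x. (f x)\<^sup>2 + (g x)\<^sup>2)"
    using assms by (simp add: square_integrable_def)
  show "(\<lambda>x. f x * g x) \<in> borel_measurable lebesgue"
    using assms by (auto simp: square_integrable_def)
  have "\<bar>a * b\<bar> \<le> a\<^sup>2 + b\<^sup>2" for a b :: real
  proof -
    have "2 * (\<bar>a\<bar> * \<bar>b\<bar>) \<le> a\<^sup>2 + b\<^sup>2"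
      using sum_squares_bound[of "\<bar>a\<bar>" "\<bar>b\<bar>"] by (simp add: mult.assoc)
    moreover have "0 \<le> \<bar>a\<bar> * \<bar>b\<bar>" by simp
    ultimately show ?thesis unfolding abs_mult by linarith
  qed
  then show "AE x in lebesgue. norm (f x * g x) \<le> norm ((f x)\<^sup>2 + (g x)\<^sup>2)"
    by (auto intro!: AE_I2)
qed

lemma square_integrable_add:
  assumes "square_integrable f" "square_integrable g"
  shows "square_integrable (\<lambda>x. f x + g x)"
  using assms square_integrable_mult[OF assms]
  by (auto simp: square_integrable_def power2_sum mult.assoc)

lemma square_integrable_diff:
  assumes "square_integrable f" "square_integrable g"
  shows "square_integrable (\<lambda>x. f x - g x)"
  using square_integrable_add[OF assms(1) square_integrable_scale[OF assms(2), of "-1"]] by simp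

quotient_type (overloaded) 'a l2 = "'a::euclidean_space \<Rightarrow> real" / partial:
  "\<lambda>f g. square_integrable f \<and> square_integrable g \<and> (AE x in lebesgue. f x = g x)"
  morphisms rep_l2 abs_l2
proof (rule part_equivpI)
  show "\<exists>f::'a \<Rightarrow> real. square_integrable f \<and> square_integrable f \<and> (AE x in lebesgue. f x = f x)"
    using square_integrable_0 by auto
  show "symp (\<lambda>f g::'a \<Rightarrow> real. square_integrable f \<and> square_integrable g \<and> (AE x in lebesgue. f x = g x))"
    by (rule sympI) (simp add: eq_commute)
  show "transp (\<lambda>f g::'a \<Rightarrow> real. square_integrable f \<and> square_integrable g \<and> (AE x in lebesgue. f x = g x))"
  proof (rule transpI)
    fix f g k :: "'a \<Rightarrow> real"
    assume 1: "square_integrable f \<and> square_integrable g \<and> (AE x in lebesgue. f x = g x)"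
      and 2: "square_integrable g \<and> square_integrable k \<and> (AE x in lebesgue. g x = k x)"
    have "AE x in lebesgue. f x = k x"
      using conjunct2[OF conjunct2[OF 1]] conjunct2[OF conjunct2[OF 2]] by eventually_elim simp
    then show "square_integrable f \<and> square_integrable k \<and> (AE x in lebesgue. f x = k x)"
      using 1 2 by simp
  qed
qed

instantiation l2 :: (euclidean_space) real_vector
begin

lift_definition zero_l2 :: "'a l2" is "\<lambda>x. 0"
  by (simp add: square_integrable_0)

lift_definition plus_l2 :: "'a l2 \<Rightarrow> 'a l2 \<Rightarrow> 'a l2" is "\<lambda>f g x. f x + g x"
  by (auto simp: square_integrable_add elim: AE_mp)

lift_definition minus_l2 :: "'a l2 \<Rightarrow> 'a l2 \<Rightarrow> 'a l2" is "\<lambda>f g x. f x - g x"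
  by (auto simp: square_integrable_diff elim: AE_mp)

lift_definition uminus_l2 :: "'a l2 \<Rightarrow> 'a l2" is "\<lambda>f x. - f x"
  using square_integrable_scale[of _ "-1"] by (auto elim: AE_mp)

lift_definition scaleR_l2 :: "real \<Rightarrow> 'a l2 \<Rightarrow> 'a l2" is "\<lambda>c f x. c * f x"
  by (auto simp: square_integrable_scale elim: AE_mp)

instance
proof
  fix u v w :: "'a l2" and a b :: real
  show "u + v + w = u + (v + w)"
    by transfer (auto simp: square_integrable_add add.assoc)
  show "u + v = v + u"
    by transfer (auto simp: square_integrable_add add.commute)
  show "0 + u = u"
    by transfer simp
  show "- u + u = 0"
    by transfer (simp add: square_integrable_0)
  show "u - v = u + - v"
    by transfer (simp add: square_integrable_diff)
  show "a *\<^sub>R (u + v) = a *\<^sub>R u + a *\<^sub>R v"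
    by transfer (simp add: distrib_left square_integrable_add square_integrable_scale)
  show "(a + b) *\<^sub>R u = a *\<^sub>R u + b *\<^sub>R u"
    by transfer (simp add: distrib_right square_integrable_add square_integrable_scale)
  show "a *\<^sub>R b *\<^sub>R u = (a * b) *\<^sub>R u"
    by transfer (simp add: mult.assoc square_integrable_scale)
  show "1 *\<^sub>R u = u"
    by transfer simp
qed

end

instantiation l2 :: (euclidean_space) real_inner
begin

lift_definition inner_l2 :: "'a l2 \<Rightarrow> 'a l2 \<Rightarrow> real" is "\<lambda>f g. LINT x|lebesgue. f x * g x"
  by (rule integral_cong_AE) (auto simp: square_integrable_def elim: AE_mp)

definition norm_l2 :: "'a l2 \<Rightarrow> real" where "norm_l2 u = sqrt (inner u u)"
definition dist_l2 :: "'a l2 \<Rightarrow> 'a l2 \<Rightarrow> real" where "dist_l2 u v = norm (u - v)"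
definition sgn_l2 :: "'a l2 \<Rightarrow> 'a l2" where "sgn_l2 u = u /\<^sub>R norm u"
definition uniformity_l2 :: "('a l2 \<times> 'a l2) filter" where
  "uniformity_l2 = (INF e\<in>{0<..}. principal {(u, v). dist u v < e})"
definition open_l2 :: "'a l2 set \<Rightarrow> bool" where
  "open_l2 S = (\<forall>u\<in>S. \<forall>\<^sub>F (u', v) in uniformity. u' = u \<longrightarrow> v \<in> S)"

instance
proof
  fix u v w :: "'a l2" and a b :: real and S :: "'a l2 set"
  show "dist u v = norm (u - v)" by (rule dist_l2_def)
  show "sgn u = u /\<^sub>R norm u" by (rule sgn_l2_def)
  show "uniformity = (INF e\<in>{0<..}. principal {(u::'a l2, v). dist u v < e})"
    by (rule uniformity_l2_def)
  show "open S = (\<forall>u\<in>S. \<forall>\<^sub>F (u', v) in uniformity. u' = u \<longrightarrow> v \<in> S)"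
    by (rule open_l2_def)
  show "inner u v = inner v u"
    by transfer (simp add: mult.commute)
  show "inner (u + v) w = inner u w + inner v w"
    by transfer (simp add: distrib_right square_integrable_mult)
  show "inner (a *\<^sub>R u) v = a * inner u v"
    by transfer (simp add: mult.assoc)
  show "0 \<le> inner u u"
    by transfer simp
  show "(inner u u = 0) = (u = 0)"
  proof transfer
    fix f :: "'a \<Rightarrow> real"
    assume "square_integrable f \<and> square_integrable f \<and> (AE x in lebesgue. f x = f x)"
    then have f: "square_integrable f" by simp
    have "((LINT x|lebesgue. f x * f x) = 0) = (AE x in lebesgue. f x * f x = 0)"
      by (rule integral_nonneg_eq_0_iff_AE) (use square_integrable_mult[OF f f] in auto)
    then show "((LINT x|lebesgue. f x * f x) = 0) =
      (square_integrable f \<and> square_integrable (\<lambda>x::'a. 0::real) \<and> (AE x in lebesgue. f x = 0))"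
      using f by (simp add: square_integrable_0)
  qed
  show "norm u = sqrt (inner u u)" by (rule norm_l2_def)
qed

end


section \<open>Domains, test functions and Sobolev spaces\<close>

primrec Ck_on :: "nat \<Rightarrow> ('a::real_normed_vector \<Rightarrow> real) \<Rightarrow> 'a set \<Rightarrow> bool" where
  "Ck_on 0 g S \<longleftrightarrow> continuous_on S g"
| "Ck_on (Suc k) g S \<longleftrightarrow>
     (\<forall>x\<in>S. g differentiable (at x)) \<and> (\<forall>v. Ck_on k (\<lambda>x. frechet_derivative g (at x) v) S)"

definition smooth :: "('a::real_normed_vector \<Rightarrow> real) \<Rightarrow> bool" where
  "smooth g \<longleftrightarrow> (\<forall>k. Ck_on k g UNIV)"

text \<open>Near each boundary point, the set lies on one side of a smooth graph over the hyperplane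
  orthogonal to some direction \<open>e\<close>.\<close>

definition smooth_boundary :: "'a::euclidean_space set \<Rightarrow> bool" where
  "smooth_boundary \<Omega> \<longleftrightarrow>
     (\<forall>p\<in>frontier \<Omega>. \<exists>\<rho>>0. \<exists>e \<gamma>. norm e = 1 \<and> smooth \<gamma> \<and>
        \<Omega> \<inter> ball p \<rho> = {x \<in> ball p \<rho>. \<gamma> (x - inner x e *\<^sub>R e) < inner x e})"

definition bounded_smooth_domain :: "'a::euclidean_space set \<Rightarrow> bool" where
  "bounded_smooth_domain \<Omega> \<longleftrightarrow>
     \<Omega> \<noteq> {} \<and> open \<Omega> \<and> connected \<Omega> \<and> bounded \<Omega> \<and> smooth_boundary \<Omega>"

definition test_function :: "'a::euclidean_space set \<Rightarrow> ('a \<Rightarrow> real) \<Rightarrow> bool" where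
  "test_function \<Omega> \<psi> \<longleftrightarrow> smooth \<psi> \<and> compact (closure {x. \<psi> x \<noteq> 0}) \<and> closure {x. \<psi> x \<noteq> 0} \<subseteq> \<Omega>"

text \<open>\<open>L\<^sup>2(\<Omega>)\<close> is identified, by extension by zero, with the closed subspace of
  functions on the whole space that vanish a.e. outside \<open>\<Omega>\<close>.\<close>

definition L2 :: "'a::euclidean_space set \<Rightarrow> 'a l2 set" where
  "L2 \<Omega> = {u. AE x in lebesgue. x \<notin> \<Omega> \<longrightarrow> rep_l2 u x = 0}"

definition weak_partial :: "'a::euclidean_space set \<Rightarrow> 'a \<Rightarrow> 'a l2 \<Rightarrow> 'a l2 \<Rightarrow> bool" where
  "weak_partial \<Omega> b u g \<longleftrightarrow>
     (\<forall>\<psi>. test_function \<Omega> \<psi> \<longrightarrow>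
        (LINT x:\<Omega>|lebesgue. rep_l2 u x * frechet_derivative \<psi> (at x) b)
          = - (LINT x:\<Omega>|lebesgue. rep_l2 g x * \<psi> x))"

definition H1 :: "'a::euclidean_space set \<Rightarrow> 'a l2 set" where
  "H1 \<Omega> = {u \<in> L2 \<Omega>. \<forall>b\<in>Basis. \<exists>g\<in>L2 \<Omega>. weak_partial \<Omega> b u g}"

definition partial :: "'a::euclidean_space set \<Rightarrow> 'a \<Rightarrow> 'a l2 \<Rightarrow> 'a l2" where
  "partial \<Omega> b u = (THE g. g \<in> L2 \<Omega> \<and> weak_partial \<Omega> b u g)"

definition grad_inner :: "'a::euclidean_space set \<Rightarrow> 'a l2 \<Rightarrow> 'a l2 \<Rightarrow> real" where
  "grad_inner \<Omega> u v = (\<Sum>b\<in>Basis. inner (partial \<Omega> b u) (partial \<Omega> b v))"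

definition H1_norm :: "'a::euclidean_space set \<Rightarrow> 'a l2 \<Rightarrow> real" where
  "H1_norm \<Omega> u = sqrt ((norm u)\<^sup>2 + grad_inner \<Omega> u u)"

definition H10 :: "'a::euclidean_space set \<Rightarrow> 'a l2 set" where
  "H10 \<Omega> = {u \<in> H1 \<Omega>. \<forall>e>0. \<exists>\<psi>. test_function \<Omega> \<psi> \<and> H1_norm \<Omega> (u - abs_l2 \<psi>) < e}"

definition H2 :: "'a::euclidean_space set \<Rightarrow> 'a l2 set" where
  "H2 \<Omega> = {u \<in> H1 \<Omega>. \<forall>b\<in>Basis. partial \<Omega> b u \<in> H1 \<Omega>}"

definition Laplacian :: "'a::euclidean_space set \<Rightarrow> 'a l2 \<Rightarrow> 'a l2" where
  "Laplacian \<Omega> u = (\<Sum>b\<in>Basis. partial \<Omega> b (partial \<Omega> b u))"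

definition V :: "'a::euclidean_space set \<Rightarrow> 'a l2 set" where
  "V \<Omega> = H2 \<Omega> \<inter> H10 \<Omega>"

text \<open>On a bounded smooth domain this is equivalent to the \<open>H\<^sup>2\<close> norm on \<open>V\<close>.\<close>

definition V_norm :: "'a::euclidean_space set \<Rightarrow> 'a l2 \<Rightarrow> real" where
  "V_norm \<Omega> u = norm (Laplacian \<Omega> u)"

text \<open>An element of the dual of \<open>V\<close> is represented by a function on the type \<open>l2\<close> of which only
  the values on \<open>V\<close> matter.\<close>

definition V_dual :: "'a::euclidean_space set \<Rightarrow> ('a l2 \<Rightarrow> real) set" where
  "V_dual \<Omega> = {w. (\<forall>x\<in>V \<Omega>. \<forall>y\<in>V \<Omega>. \<forall>a b. w (a *\<^sub>R x + b *\<^sub>R y) = a * w x + b * w y) \<and>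
                   (\<exists>K. \<forall>x\<in>V \<Omega>. \<bar>w x\<bar> \<le> K * V_norm \<Omega> x)}"

definition V_dual_norm :: "'a::euclidean_space set \<Rightarrow> ('a l2 \<Rightarrow> real) \<Rightarrow> real" where
  "V_dual_norm \<Omega> w = (SUP x\<in>{x \<in> V \<Omega>. V_norm \<Omega> x \<le> 1}. \<bar>w x\<bar>)"


section \<open>Functions of time with values in a normed space\<close>

text \<open>The space of values is given by a carrier \<open>X\<close> together with its norm \<open>nX\<close>, so that
  the same definitions serve \<open>L\<^sup>2\<close>, \<open>H\<^sub>0\<^sup>1\<close>, \<open>V\<close> and the dual of \<open>V\<close>.\<close>

definition cont_into :: "'x set \<Rightarrow> ('x::minus \<Rightarrow> real) \<Rightarrow> real set \<Rightarrow> (real \<Rightarrow> 'x) \<Rightarrow> bool" where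
  "cont_into X nX I u \<longleftrightarrow>
     (\<forall>t\<in>I. u t \<in> X \<and> ((\<lambda>s. nX (u s - u t)) \<longlongrightarrow> 0) (at t within I))"

definition strongly_measurable_into ::
  "'x set \<Rightarrow> ('x::minus \<Rightarrow> real) \<Rightarrow> real set \<Rightarrow> (real \<Rightarrow> 'x) \<Rightarrow> bool" where
  "strongly_measurable_into X nX I u \<longleftrightarrow>
     (\<exists>s :: nat \<Rightarrow> real \<Rightarrow> 'x.
        (\<forall>k. simple_function (lebesgue_on I) (s k) \<and> s k ` I \<subseteq> X) \<and>
        (AE t in lebesgue_on I. u t \<in> X \<and> (\<lambda>k. nX (s k t - u t)) \<longlonglongrightarrow> 0))"

definition Linf_into :: "'x set \<Rightarrow> ('x::minus \<Rightarrow> real) \<Rightarrow> real set \<Rightarrow> (real \<Rightarrow> 'x) \<Rightarrow> bool" where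
  "Linf_into X nX I u \<longleftrightarrow>
     strongly_measurable_into X nX I u \<and> (\<exists>M. AE t in lebesgue_on I. nX (u t) \<le> M)"

definition L2_into :: "'x set \<Rightarrow> ('x::minus \<Rightarrow> real) \<Rightarrow> real set \<Rightarrow> (real \<Rightarrow> 'x) \<Rightarrow> bool" where
  "L2_into X nX I u \<longleftrightarrow>
     strongly_measurable_into X nX I u \<and> integrable (lebesgue_on I) (\<lambda>t. (nX (u t))\<^sup>2)"

definition L2_loc_into :: "'x set \<Rightarrow> ('x::minus \<Rightarrow> real) \<Rightarrow> (real \<Rightarrow> 'x) \<Rightarrow> bool" where
  "L2_loc_into X nX u \<longleftrightarrow> (\<forall>a b. a < b \<longrightarrow> L2_into X nX {a..b} u)"


section \<open>History spaces\<close>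

text \<open>Histories are extensional functions on \<open>[-r, 0]\<close>, so that equality of histories is
  equality on that interval and the sup norm is definite.\<close>

definition C_hist :: "real \<Rightarrow> 'x set \<Rightarrow> ('x::minus \<Rightarrow> real) \<Rightarrow> (real \<Rightarrow> 'x) set" where
  "C_hist r X nX = {\<xi> \<in> extensional {-r..0}. cont_into X nX {-r..0} \<xi>}"

definition sup_norm :: "real \<Rightarrow> ('x \<Rightarrow> real) \<Rightarrow> (real \<Rightarrow> 'x) \<Rightarrow> real" where
  "sup_norm r nX \<xi> = (SUP \<theta>\<in>{-r..0}. nX (\<xi> \<theta>))"

definition history :: "real \<Rightarrow> (real \<Rightarrow> 'x) \<Rightarrow> real \<Rightarrow> real \<Rightarrow> 'x" where
  "history r u t = restrict (\<lambda>\<theta>. u (t + \<theta>)) {-r..0}"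

type_synonym 'a hist = "(real \<Rightarrow> 'a l2) \<times> (real \<Rightarrow> 'a l2)"

definition Hc :: "'a::euclidean_space set \<Rightarrow> real \<Rightarrow> 'a hist set" where
  "Hc \<Omega> r = {(\<phi>0, \<phi>1). \<phi>0 \<in> C_hist r (V \<Omega>) (V_norm \<Omega>) \<and> \<phi>1 \<in> C_hist r (L2 \<Omega>) norm \<and>
     (\<forall>\<theta>\<in>{-r..0}. (\<phi>0 has_vector_derivative \<phi>1 \<theta>) (at \<theta> within {-r..0}))}"

definition Hc_norm :: "'a::euclidean_space set \<Rightarrow> real \<Rightarrow> 'a hist \<Rightarrow> real" where
  "Hc_norm \<Omega> r \<phi> = sqrt ((sup_norm r (V_norm \<Omega>) (fst \<phi>))\<^sup>2 + (sup_norm r norm (snd \<phi>))\<^sup>2)"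


section \<open>Structural hypotheses\<close>

definition primitive :: "(real \<Rightarrow> real) \<Rightarrow> real \<Rightarrow> real" where
  "primitive f s = (LBINT \<xi>=0..ereal s. f \<xi>)"

definition nemytskii :: "(real \<Rightarrow> real) \<Rightarrow> 'a::euclidean_space l2 \<Rightarrow> 'a l2" where
  "nemytskii f u = abs_l2 (\<lambda>x. f (rep_l2 u x))"

definition growth_condition :: "nat \<Rightarrow> (real \<Rightarrow> real) \<Rightarrow> bool" where
  "growth_condition N f \<longleftrightarrow>
     (if N > 4
      then \<exists>C>0. \<exists>\<rho>. 1 \<le> \<rho> \<and> \<rho> \<le> real N / (real N - 4) \<and>
             (\<forall>s. \<bar>f s\<bar> \<le> C * (1 + \<bar>s\<bar> powr \<rho>))
      else \<exists>C>0. \<exists>\<rho>\<ge>1. \<forall>s. \<bar>f s\<bar> \<le> C * (1 + \<bar>s\<bar> powr \<rho>))"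

text \<open>Square integrability of \<open>f(u) - f(v)\<close> is what it means for the left-hand norm to be finite;
  it has to be stated because \<open>abs_l2\<close> is meaningless on other functions.\<close>

definition loc_lipschitz :: "'a::euclidean_space set \<Rightarrow> (real \<Rightarrow> real) \<Rightarrow> bool" where
  "loc_lipschitz \<Omega> f \<longleftrightarrow>
     (\<forall>R>0. \<exists>L>0. \<forall>u\<in>V \<Omega>. \<forall>v\<in>V \<Omega>. V_norm \<Omega> u + V_norm \<Omega> v \<le> R \<longrightarrow>
        square_integrable (\<lambda>x. f (rep_l2 u x) - f (rep_l2 v x)) \<and>
        norm (nemytskii f u - nemytskii f v) \<le> L * V_norm \<Omega> (u - v))"

definition f_hypotheses :: "'a::euclidean_space set \<Rightarrow> real \<Rightarrow> (real \<Rightarrow> real) \<Rightarrow> bool" where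
  "f_hypotheses \<Omega> lam f \<longleftrightarrow>
     f C1_differentiable_on UNIV \<and> f 0 = 0 \<and>
     (\<exists>Cf>0. \<forall>s. primitive f s \<ge> - Cf - lam / 4 * s\<^sup>2) \<and>
     (\<exists>\<mu>0>0. \<exists>\<delta>0>0. \<exists>C0>0. \<forall>s. f s * s \<ge> \<mu>0 * primitive f s - \<delta>0 * s\<^sup>2 - C0) \<and>
     growth_condition DIM('a) f \<and> loc_lipschitz \<Omega> f"

definition G_hypotheses ::
  "'a::euclidean_space set \<Rightarrow> real \<Rightarrow> (real \<Rightarrow> (real \<Rightarrow> 'a l2) \<Rightarrow> 'a l2) \<Rightarrow> bool" where
  "G_hypotheses \<Omega> r G \<longleftrightarrow>
     (let CH = C_hist r (L2 \<Omega>) norm in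
       (\<forall>t. \<forall>\<xi>\<in>CH. G t \<xi> \<in> L2 \<Omega>) \<and>
       (\<forall>\<xi>\<in>CH. (\<lambda>t. G t \<xi>) \<in> borel_measurable lebesgue) \<and>
       (\<forall>t. G t (restrict (\<lambda>_. 0) {-r..0}) = 0) \<and>
       (\<exists>LG>0. \<forall>t. \<forall>\<xi>\<in>CH. \<forall>\<eta>\<in>CH.
          norm (G t \<xi> - G t \<eta>) \<le> LG * sup_norm r norm (\<lambda>\<theta>. \<xi> \<theta> - \<eta> \<theta>)) \<and>
       (\<exists>m0>0. \<exists>C1>0. \<forall>m\<in>{0..m0}. \<forall>\<tau> t u v. \<tau> \<le> t \<longrightarrow>
          cont_into (L2 \<Omega>) norm {\<tau>-r..t} u \<longrightarrow> cont_into (L2 \<Omega>) norm {\<tau>-r..t} v \<longrightarrow>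
          (LINT s:{\<tau>..t}|lebesgue. exp (m * s) * (norm (G s (history r u s) - G s (history r v s)))\<^sup>2)
            \<le> C1 * (LINT s:{\<tau>-r..t}|lebesgue. exp (m * s) * (norm (u s - v s))\<^sup>2)))"


section \<open>Weak solutions and the process\<close>

text \<open>A solution is a pair \<open>(u, v)\<close> with \<open>v = u\<^sub>t\<close>, and \<open>w\<close> is \<open>u\<^sub>t\<^sub>t\<close>; both time derivatives on
  \<open>(\<tau>, T)\<close> are distributional. The regularity in the definition makes \<open>u\<close> continuous into
  \<open>L\<^sup>2\<close> and \<open>v\<close> weakly continuous into \<open>L\<^sup>2\<close> up to null sets of times; the first three clauses
  select these representatives, without which pointwise initial conditions and histories would be
  meaningless.\<close>

definition weak_solution ::
  "'a::euclidean_space set \<Rightarrow> real \<Rightarrow> real \<Rightarrow> (real \<Rightarrow> real) \<Rightarrow>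
   (real \<Rightarrow> (real \<Rightarrow> 'a l2) \<Rightarrow> 'a l2) \<Rightarrow> (real \<Rightarrow> 'a l2) \<Rightarrow>
   real \<Rightarrow> real \<Rightarrow> 'a hist \<Rightarrow> (real \<Rightarrow> 'a l2) \<Rightarrow> (real \<Rightarrow> 'a l2) \<Rightarrow> bool" where
  "weak_solution \<Omega> lam r f G h \<tau> T \<phi> u v \<longleftrightarrow>
     cont_into (L2 \<Omega>) norm {\<tau>-r..T} u \<and>
     (\<forall>t\<in>{\<tau>-r..T}. v t \<in> L2 \<Omega>) \<and>
     (\<forall>x\<in>L2 \<Omega>. continuous_on {\<tau>-r..T} (\<lambda>t. inner (v t) x)) \<and>
     (\<forall>t\<in>{\<tau>-r..\<tau>}. u t = fst \<phi> (t - \<tau>) \<and> v t = snd \<phi> (t - \<tau>)) \<and>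
     Linf_into (V \<Omega>) (V_norm \<Omega>) {\<tau><..<T} u \<and>
     Linf_into (L2 \<Omega>) norm {\<tau><..<T} v \<and>
     L2_into (H10 \<Omega>) (H1_norm \<Omega>) {\<tau><..<T} v \<and>
     (\<forall>x\<in>L2 \<Omega>. \<forall>\<psi>. test_function {\<tau><..<T} \<psi> \<longrightarrow>
        (LINT t:{\<tau><..<T}|lebesgue. inner (u t) x * deriv \<psi> t)
          = - (LINT t:{\<tau><..<T}|lebesgue. inner (v t) x * \<psi> t)) \<and>
     (\<exists>w. L2_into (V_dual \<Omega>) (V_dual_norm \<Omega>) {\<tau><..<T} w \<and>
        (\<forall>x\<in>V \<Omega>. \<forall>\<psi>. test_function {\<tau><..<T} \<psi> \<longrightarrow>
           (LINT t:{\<tau><..<T}|lebesgue. inner (v t) x * deriv \<psi> t)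
             = - (LINT t:{\<tau><..<T}|lebesgue. w t x * \<psi> t)) \<and>
        (\<forall>x\<in>V \<Omega>. AE t in lebesgue_on {\<tau><..<T}.
           w t x + grad_inner \<Omega> (v t) x + inner (Laplacian \<Omega> (u t)) (Laplacian \<Omega> x)
             + lam * inner (u t) x + inner (nemytskii f (u t)) x
           = inner (G t (history r u t)) x + inner (h t) x))"

definition well_posed ::
  "'a::euclidean_space set \<Rightarrow> real \<Rightarrow> real \<Rightarrow> (real \<Rightarrow> real) \<Rightarrow>
   (real \<Rightarrow> (real \<Rightarrow> 'a l2) \<Rightarrow> 'a l2) \<Rightarrow> (real \<Rightarrow> 'a l2) \<Rightarrow> bool" where
  "well_posed \<Omega> lam r f G h \<longleftrightarrow>
     (\<forall>\<tau> T. \<forall>\<phi>\<in>Hc \<Omega> r. \<tau> < T \<longrightarrow>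
        (\<exists>u v. weak_solution \<Omega> lam r f G h \<tau> T \<phi> u v \<and>
           cont_into (V \<Omega>) (V_norm \<Omega>) {\<tau>-r..T} u \<and>
           cont_into (L2 \<Omega>) norm {\<tau>-r..T} v \<and>
           (\<forall>t\<in>{\<tau>..T}. (history r u t, history r v t) \<in> Hc \<Omega> r) \<and>
           (\<forall>u' v'. weak_solution \<Omega> lam r f G h \<tau> T \<phi> u' v' \<longrightarrow>
              (\<forall>t\<in>{\<tau>-r..T}. u' t = u t \<and> v' t = v t))))"

definition process ::
  "'a::euclidean_space set \<Rightarrow> real \<Rightarrow> real \<Rightarrow> (real \<Rightarrow> real) \<Rightarrow>
   (real \<Rightarrow> (real \<Rightarrow> 'a l2) \<Rightarrow> 'a l2) \<Rightarrow> (real \<Rightarrow> 'a l2) \<Rightarrow>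
   real \<Rightarrow> real \<Rightarrow> 'a hist \<Rightarrow> 'a hist" where
  "process \<Omega> lam r f G h t \<tau> \<phi> =
     (THE \<xi>. \<exists>T u v. t < T \<and> weak_solution \<Omega> lam r f G h \<tau> T \<phi> u v \<and>
        \<xi> = (history r u t, history r v t))"


section \<open>The modified energy and its constants\<close>

definition energy ::
  "'a::euclidean_space set \<Rightarrow> real \<Rightarrow> (real \<Rightarrow> real) \<Rightarrow> real \<Rightarrow> real \<Rightarrow>
   (real \<Rightarrow> 'a l2) \<Rightarrow> (real \<Rightarrow> 'a l2) \<Rightarrow> real \<Rightarrow> real" where
  "energy \<Omega> lam f \<epsilon> K0 u v t =
     (norm (v t))\<^sup>2 + (norm (Laplacian \<Omega> (u t)))\<^sup>2 + lam * (norm (u t))\<^sup>2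
       + 2 * (LINT x:\<Omega>|lebesgue. primitive f (rep_l2 (u t) x))
       + \<epsilon> * (2 * inner (v t) (u t) + grad_inner \<Omega> (u t) (u t)) + K0"

text \<open>In the next three definitions the constants hidden by existential quantifiers, like the
  parameters themselves, are uniform in the solution, the initial time, the final time and the
  datum. The energy is differentiable at almost every time only, hence the form of the
  differential inequality.\<close>

definition energy_parameters ::
  "'a::euclidean_space set \<Rightarrow> real \<Rightarrow> real \<Rightarrow> (real \<Rightarrow> real) \<Rightarrow>
   (real \<Rightarrow> (real \<Rightarrow> 'a l2) \<Rightarrow> 'a l2) \<Rightarrow> (real \<Rightarrow> 'a l2) \<Rightarrow> real \<Rightarrow> real \<Rightarrow> bool" where
  "energy_parameters \<Omega> lam r f G h \<epsilon> K0 \<longleftrightarrow>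
     0 < \<epsilon> \<and> \<epsilon> < 1 \<and> 0 < K0 \<and>
     (\<exists>C5>0. \<exists>C6>0. \<forall>\<tau> T u v. \<forall>\<phi>\<in>Hc \<Omega> r. \<tau> < T \<longrightarrow>
        weak_solution \<Omega> lam r f G h \<tau> T \<phi> u v \<longrightarrow>
        (\<forall>t\<in>{\<tau>..T}.
           C5 * ((norm (v t))\<^sup>2 + (norm (Laplacian \<Omega> (u t)))\<^sup>2) \<le> energy \<Omega> lam f \<epsilon> K0 u v t \<and>
           energy \<Omega> lam f \<epsilon> K0 u v t
             \<le> C6 * (1 + (norm (v t))\<^sup>2 + (norm (Laplacian \<Omega> (u t)))\<^sup>2
                        + (LINT x:\<Omega>|lebesgue. primitive f (rep_l2 (u t) x)))))"

definition dissipation_rate ::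
  "'a::euclidean_space set \<Rightarrow> real \<Rightarrow> real \<Rightarrow> (real \<Rightarrow> real) \<Rightarrow>
   (real \<Rightarrow> (real \<Rightarrow> 'a l2) \<Rightarrow> 'a l2) \<Rightarrow> (real \<Rightarrow> 'a l2) \<Rightarrow> real \<Rightarrow> real \<Rightarrow> real \<Rightarrow> bool" where
  "dissipation_rate \<Omega> lam r f G h \<epsilon> K0 \<beta> \<longleftrightarrow>
     0 < \<beta> \<and>
     (\<exists>C>0. \<forall>\<tau> T u v. \<forall>\<phi>\<in>Hc \<Omega> r. \<tau> < T \<longrightarrow>
        weak_solution \<Omega> lam r f G h \<tau> T \<phi> u v \<longrightarrow>
        (AE t in lebesgue_on {\<tau><..<T}. \<exists>L'.
           (energy \<Omega> lam f \<epsilon> K0 u v has_real_derivative L') (at t) \<and>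
           L' + \<beta> * energy \<Omega> lam f \<epsilon> K0 u v t
             \<le> C * (norm (G t (history r u t)))\<^sup>2 + C * (norm (h t))\<^sup>2 + C))"

definition delay_constant ::
  "'a::euclidean_space set \<Rightarrow> real \<Rightarrow> real \<Rightarrow> (real \<Rightarrow> real) \<Rightarrow>
   (real \<Rightarrow> (real \<Rightarrow> 'a l2) \<Rightarrow> 'a l2) \<Rightarrow> (real \<Rightarrow> 'a l2) \<Rightarrow>
   real \<Rightarrow> real \<Rightarrow> real \<Rightarrow> real \<Rightarrow> bool" where
  "delay_constant \<Omega> lam r f G h \<epsilon> K0 \<beta> \<delta>G \<longleftrightarrow>
     0 < \<delta>G \<and>
     (\<exists>C>0. \<forall>\<tau> T u v. \<forall>\<phi>\<in>Hc \<Omega> r. \<tau> < T \<longrightarrow>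
        weak_solution \<Omega> lam r f G h \<tau> T \<phi> u v \<longrightarrow>
        (\<forall>t\<in>{\<tau>..T}.
           energy \<Omega> lam f \<epsilon> K0 u v t * exp (\<beta> * t)
             \<le> C * exp (\<beta> * \<tau>) * (1 + (sup_norm r (V_norm \<Omega>) (fst \<phi>))\<^sup>2
                                      + (sup_norm r norm (snd \<phi>))\<^sup>2)
               + \<delta>G * (LINT s:{\<tau>..t}|lebesgue. exp (\<beta> * s) * energy \<Omega> lam f \<epsilon> K0 u v s)
               + C * (LINT s:{\<tau>..t}|lebesgue. exp (\<beta> * s) * (norm (h s))\<^sup>2)
               + C * (LINT s:{\<tau>..t}|lebesgue. exp (\<beta> * s))))"


section \<open>Pullback absorption\<close>

text \<open>The supremum is taken in the extended reals, so that unbounded members are not tempered.\<close>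

definition tempered :: "real \<Rightarrow> 'x set \<Rightarrow> ('x \<Rightarrow> real) \<Rightarrow> (real \<Rightarrow> 'x set) set" where
  "tempered \<alpha> X nX =
     {D. (\<forall>t. D t \<noteq> {} \<and> D t \<subseteq> X) \<and>
         ((\<lambda>\<tau>. ennreal (exp (\<alpha> * \<tau>)) * (SUP \<xi>\<in>D \<tau>. ennreal ((nX \<xi>)\<^sup>2))) \<longlongrightarrow> 0) at_bot}"

definition pullback_absorbing ::
  "(real \<Rightarrow> real \<Rightarrow> 'x \<Rightarrow> 'x) \<Rightarrow> (real \<Rightarrow> 'x set) set \<Rightarrow> (real \<Rightarrow> 'x set) \<Rightarrow> bool" where
  "pullback_absorbing U \<D> D0 \<longleftrightarrow>
     (\<forall>t. \<forall>D\<in>\<D>. \<exists>\<tau>0\<le>t. \<forall>\<tau>\<le>\<tau>0. U t \<tau> ` D \<tau> \<subseteq> D0 t)"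

end

theory Submission
  imports Defs
begin

text \<open>Gronwall's inequality, with the kernel kept inside the integral, turns the inequality defining
  \<open>\<delta>\<^sub>G\<close> into decay of the energy at rate \<open>\<alpha> = \<beta> - \<delta>\<^sub>G\<close>, with the forcing weighted by \<open>exp (\<alpha> * s)\<close>.
  Applied on \<open>[t - r, t]\<close>, this bounds the history at time \<open>t\<close>, and a tempered family of data loses its
  contribution as the initial time tends to \<open>-\<infinity>\<close>. Two points concern the encoding: the solution
  chosen by the process does not depend on its final time, since weak solutions restrict to shorter
  intervals; and the absorbing sets are nonempty because the zero history is admissible, which needs
  uniqueness of weak derivatives, i.e. the fundamental lemma of the calculus of variations.\<close>

section \<open>A Gronwall inequality\<close>

text \<open>The kernel has to stay inside the integral: replacing
  \<open>exp (\<delta> * (t - s))\<close> by its maximum over \<open>[\<tau>, t]\<close> would put a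
  factor \<open>exp (- \<delta> * \<tau>)\<close> in front of the forcing, which blows up as \<tau>
  tends to minus infinity. Kept inside, it combines with \<open>exp (\<beta> * s)\<close> to
  \<open>exp (\<delta> * t) * exp (\<alpha> * s)\<close>, and multiplying by
  \<open>exp (- \<beta> * t)\<close> leaves exactly the weight whose integral over the past is
  assumed finite. Temperedness uses the same exponent \<alpha>, which is why the datum's share
  vanishes for every family in the class. The shift by \<open>r\<close> in the radius comes from the
  oldest point of the window, where the decaying exponentials are largest. Multiplying the squared
  radius by \<open>exp (\<alpha> * t)\<close> cancels its exponential up to the constant
  \<open>exp (\<alpha> * r)\<close> and leaves a tail integral, so the absorbing family belongs to
  its own class. The fundamental lemma enters because \<open>partial\<close> is a definite
  description: until weak derivatives are unique, even the norm of the zero history is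
  undetermined.\<close>

text \<open>On a uniform partition each increment is at most \<open>c\<close> times the mesh times
  the increment of \<open>B\<close>. The increments of \<open>B\<close> telescope, so the total is
  of the order of the mesh, which is arbitrarily small.\<close>

lemma telescoping_decrease:
  fixes W B :: "real \<Rightarrow> real"
  assumes "a \<le> b"
    and step: "\<And>s t. a \<le> s \<Longrightarrow> s \<le> t \<Longrightarrow> t \<le> b \<Longrightarrow> W t - W s \<le> c * (t - s) * (B t - B s)"
  shows "W b \<le> W a"
proof -
  have "W b - W a \<le> c * (b - a) * (B b - B a) / real (Suc n)" for n
  proof -
    define d where "d = (b - a) / real (Suc n)"
    have d: "0 \<le> d" "real (Suc n) * d = b - a"
      using assms(1) by (simp_all add: d_def del: of_nat_Suc)
    define p where "p i = a + real i * d" for i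
    have p: "a \<le> p i" "p i \<le> p (Suc i)" "p (Suc i) - p i = d" for i
      using d(1) by (auto simp: p_def algebra_simps)
    have pn: "p 0 = a" "p (Suc n) = b"
      using d(2) by (simp_all add: p_def del: of_nat_Suc)
    have pmono: "p i \<le> p j" if "i \<le> j" for i j
      using p(2) that by (rule lift_Suc_mono_le)
    have tele: "(\<Sum>i<Suc n. g (p (Suc i)) - g (p i)) = g b - g a" for g :: "real \<Rightarrow> real"
      using sum_lessThan_telescope[of "\<lambda>i. g (p i)" "Suc n"] by (simp only: pn)
    have "W b - W a = (\<Sum>i<Suc n. W (p (Suc i)) - W (p i))"
      by (simp only: tele)
    also have "\<dots> \<le> (\<Sum>i<Suc n. c * d * (B (p (Suc i)) - B (p i)))"
    proof (rule sum_mono)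
      fix i assume "i \<in> {..<Suc n}"
      then have "p (Suc i) \<le> b" using pmono[of "Suc i" "Suc n"] pn by auto
      from step[OF p(1) p(2) this] show "W (p (Suc i)) - W (p i)
          \<le> c * d * (B (p (Suc i)) - B (p i))"
        unfolding p(3) .
    qed
    also have "\<dots> = c * d * (B b - B a)"
      by (simp only: tele flip: sum_distrib_left)
    finally show ?thesis by (simp add: d_def)
  qed
  moreover have "(\<lambda>n. c * (b - a) * (B b - B a) / real (Suc n)) \<longlonglongrightarrow> 0"
    by (rule LIMSEQ_Suc, rule lim_const_over_n)
  ultimately have "W b - W a \<le> 0"
    by (intro LIMSEQ_le_const) auto
  then show ?thesis by simp
qed

lemma set_integrable_mult_continuous:
  fixes g k :: "real \<Rightarrow> real"
  assumes "set_integrable lebesgue {a..b} k" "continuous_on {a..b} g"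
  shows "set_integrable lebesgue {a..b} (\<lambda>s. g s * k s)"
proof -
  obtain M where M: "\<And>s. s \<in> {a..b} \<Longrightarrow> \<bar>g s\<bar> \<le> M"
    using compact_imp_bounded[OF compact_continuous_image[OF assms(2) compact_Icc]]
    unfolding bounded_iff by (metis image_eqI real_norm_def)
  have "set_borel_measurable borel {a..b} g"
    by (rule borel_measurable_continuous_on_indicator[OF _ assms(2), unfolded set_borel_measurable_def[symmetric]]) auto
  then have gm: "(\<lambda>s. indicator {a..b} s * g s) \<in> borel_measurable lebesgue"
    by (auto simp: set_borel_measurable_def intro: measurable_completion)
  have km: "integrable lebesgue (\<lambda>s. indicator {a..b} s * k s)"
    using assms(1) by (simp add: set_integrable_def)
  \<comment> \<open>Both factors carry the indicator, since \<open>g\<close> is known to be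
    measurable and bounded only after being cut off to the interval; an indicator is its own
    square.\<close>
  have "integrable lebesgue (\<lambda>s. (indicator {a..b} s * g s) * (indicator {a..b} s * k s))"
  proof (rule Bochner_Integration.integrable_bound)
    show "integrable lebesgue (\<lambda>s. M * (indicator {a..b} s * k s))"
      using km by simp
    show "AE s in lebesgue. norm (indicator {a..b} s * g s * (indicator {a..b} s * k s))
          \<le> norm (M * (indicator {a..b} s * k s))"
    proof (intro AE_I2)
      fix s
      have "\<bar>g s\<bar> * \<bar>k s\<bar> \<le> \<bar>M\<bar> * \<bar>k s\<bar>" if "s \<in> {a..b}"
        using M[OF that] by (intro mult_right_mono) auto
      then show "norm (indicator {a..b} s * g s * (indicator {a..b} s * k s))
          \<le> norm (M * (indicator {a..b} s * k s))"
        by (cases "s \<in> {a..b}") (auto simp: abs_mult)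
    qed
  qed (use gm km in auto)
  then show ?thesis
    unfolding set_integrable_def
    by (rule back_subst[of "integrable lebesgue"]) (auto simp: indicator_def fun_eq_iff)
qed

text \<open>With \<open>B\<close> the right-hand side of the hypothesis, \<open>exp (-\<delta>t) * B t\<close> minus the integral of
  \<open>exp (-\<delta>s) * k s\<close> has increments of second order, hence decreases. This needs neither a
  derivative nor Fubini, which matters because \<open>y\<close> and \<open>k\<close> are merely integrable.\<close>

lemma gronwall:
  fixes y k :: "real \<Rightarrow> real"
  assumes ab: "a \<le> b" and \<delta>: "0 \<le> \<delta>"
    and y: "set_integrable lebesgue {a..b} y" and k: "set_integrable lebesgue {a..b} k"
    and y0: "\<And>t. t \<in> {a..b} \<Longrightarrow> 0 \<le> y t" and k0: "\<And>t. t \<in> {a..b} \<Longrightarrow> 0 \<le> k t"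
    and le: "\<And>t. t \<in> {a..b} \<Longrightarrow>
      y t \<le> A + (LINT s:{a..t}|lebesgue. k s) + \<delta> * (LINT s:{a..t}|lebesgue. y s)"
  shows "y b \<le> exp (\<delta> * (b - a)) * A + (LINT s:{a..b}|lebesgue. exp (\<delta> * (b - s)) * k s)"
proof -
  define B where "B t = A + (LINT s:{a..t}|lebesgue. k s) + \<delta> * (LINT s:{a..t}|lebesgue. y s)" for t
  define W where "W t = exp (- \<delta> * t) * B t - (LINT s:{a..t}|lebesgue. exp (- \<delta> * s) * k s)" for t
  have ke: "set_integrable lebesgue {a..b} (\<lambda>s. exp (- \<delta> * s) * k s)"
    by (intro set_integrable_mult_continuous[OF k] continuous_intros)
  have shift: "exp (\<delta> * c) * (exp (- \<delta> * s) * z) = exp (\<delta> * (c - s)) * z" for c s z :: real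
    by (simp add: right_diff_distrib exp_diff exp_minus field_simps)
  have split: "(LINT x:{a..t}|lebesgue. g x) = (LINT x:{a..s}|lebesgue. g x) + (LINT x:{s<..t}|lebesgue. g x)"
    if "set_integrable lebesgue {a..b} g" "a \<le> s" "s \<le> t" "t \<le> b" for g :: "real \<Rightarrow> real" and s t
  proof -
    have "{a..t} = {a..s} \<union> {s<..t}" using that by auto
    moreover have "set_integrable lebesgue {a..s} g" "set_integrable lebesgue {s<..t} g"
      using that by (auto intro: set_integrable_subset[OF that(1)])
    ultimately show ?thesis by (subst \<open>{a..t} = _\<close>, intro set_integral_Un) auto
  qed
  have "W b \<le> W a"
  proof (rule telescoping_decrease[OF ab])
    fix s t assume st: "a \<le> s" "s \<le> t" "t \<le> b"
    have sub: "set_integrable lebesgue {s<..t} g" if "set_integrable lebesgue {a..b} g" for g :: "real \<Rightarrow> real"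
      using st by (intro set_integrable_subset[OF that]) auto
    have const: "set_integrable lebesgue {s<..t} (\<lambda>_. c)"
      "(LINT x:{s<..t}|lebesgue. c) = (t - s) * c" for c :: real
      using st by (auto simp: set_integrable_def set_lebesgue_integral_def)
    have mono: "(LINT x:{s<..t}|lebesgue. g x) \<le> (LINT x:{s<..t}|lebesgue. g' x)"
      if "set_integrable lebesgue {s<..t} g" "set_integrable lebesgue {s<..t} g'"
        "\<And>x. x \<in> {s<..t} \<Longrightarrow> g x \<le> g' x" for g g' :: "real \<Rightarrow> real"
      using that by (rule set_integral_mono)
    define Kst where "Kst = (LINT x:{s<..t}|lebesgue. k x)"
    define Yst where "Yst = (LINT x:{s<..t}|lebesgue. y x)"
    have Bst: "B t = B s + Kst + \<delta> * Yst"
      unfolding B_def Kst_def Yst_def split[OF k st] split[OF y st] by (simp add: algebra_simps)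
    have Bmono: "B x \<le> B t" if "a \<le> x" "x \<le> t" for x
    proof -
      have "0 \<le> (LINT z:{x<..t}|lebesgue. k z)" "0 \<le> (LINT z:{x<..t}|lebesgue. y z)"
        unfolding set_lebesgue_integral_def using k0 y0 st that
        by (intro integral_nonneg_AE AE_I2; auto simp: indicator_def)+
      then show ?thesis
        unfolding B_def split[OF k that st(3)] split[OF y that st(3)]
        using \<delta> by (simp add: algebra_simps)
    qed
    have "Yst \<le> (LINT x:{s<..t}|lebesgue. B t)"
      unfolding Yst_def
    proof (rule mono[OF sub[OF y] const(1)])
      fix x assume "x \<in> {s<..t}"
      with st show "y x \<le> B t" using le[of x] Bmono[of x] unfolding B_def by auto
    qed
    then have Y: "Yst \<le> (t - s) * B t" unfolding const .
    have "(LINT x:{s<..t}|lebesgue. exp (- \<delta> * t) * k x) \<le> (LINT x:{s<..t}|lebesgue. exp (- \<delta> * x) * k x)"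
    proof (rule mono)
      fix x assume "x \<in> {s<..t}"
      with st \<delta> k0[of x] show "exp (- \<delta> * t) * k x \<le> exp (- \<delta> * x) * k x"
        by (intro mult_right_mono) (auto intro: mult_left_mono)
    qed (use sub[OF k] sub[OF ke] in auto)
    then have K: "exp (- \<delta> * t) * Kst \<le> (LINT x:{s<..t}|lebesgue. exp (- \<delta> * x) * k x)"
      unfolding Kst_def by simp
    have B0: "0 \<le> B s" "0 \<le> B t - B s"
      using y0[of s] le[of s] Bmono[of s] st unfolding B_def by auto
    have e: "1 + \<delta> * (t - s) \<le> exp (\<delta> * (t - s))" by (rule exp_ge_add_one_self)
    have "W t - W s = exp (- \<delta> * t) * B t - exp (- \<delta> * s) * B s
        - (LINT x:{s<..t}|lebesgue. exp (- \<delta> * x) * k x)"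
      unfolding W_def split[OF ke st] by simp
    also have "\<dots> \<le> exp (- \<delta> * t) * B t - exp (- \<delta> * s) * B s - exp (- \<delta> * t) * Kst"
      using K by simp
    also have "\<dots> = exp (- \<delta> * t) * (B t - Kst - exp (\<delta> * (t - s)) * B s)"
      by (simp add: right_diff_distrib exp_diff exp_minus field_simps)
    \<comment> \<open>Here \<open>B t - Kst\<close> equals \<open>B s + \<delta> * Yst\<close>. With
      \<open>Yst \<le> (t - s) * B t\<close> and the tangent bound for the exponential, the
      first-order terms cancel up to \<open>\<delta> * (t - s) * (B t - B s)\<close>, the
      second-order form that telescopes.\<close>
    also have "\<dots> \<le> exp (- \<delta> * t) * (\<delta> * (t - s) * (B t - B s))"
    proof (rule mult_left_mono)
      have "\<delta> * Yst \<le> \<delta> * ((t - s) * B t)" using Y \<delta> by (rule mult_left_mono)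
      moreover have "(1 + \<delta> * (t - s)) * B s \<le> exp (\<delta> * (t - s)) * B s"
        using e B0(1) by (rule mult_right_mono)
      ultimately show "B t - Kst - exp (\<delta> * (t - s)) * B s \<le> \<delta> * (t - s) * (B t - B s)"
        using Bst by (simp add: algebra_simps)
    qed simp
    \<comment> \<open>The telescoping argument requires a constant that does not vary with the
      subinterval, so the exponential is replaced by its largest value, at \<open>a\<close>.\<close>
    also have "\<dots> \<le> exp (- \<delta> * a) * (\<delta> * (t - s) * (B t - B s))"
      using st \<delta> B0 by (intro mult_right_mono mult_nonneg_nonneg) (auto intro: mult_left_mono)
    finally show "W t - W s \<le> exp (- \<delta> * a) * \<delta> * (t - s) * (B t - B s)"
      by (simp add: mult.assoc)
  qed
  moreover have "(LINT x:{a..a}|lebesgue. g x) = 0" for g :: "real \<Rightarrow> real"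
    unfolding set_lebesgue_integral_def
    by (rule integral_eq_zero_AE, rule AE_mp[OF AE_not_in[of "{a}"]]) auto
  then have "W a = exp (- \<delta> * a) * A"
    by (simp add: W_def B_def)
  ultimately have "exp (- \<delta> * b) * B b \<le> exp (- \<delta> * a) * A + (LINT s:{a..b}|lebesgue. exp (- \<delta> * s) * k s)"
    by (simp add: W_def)
  then have "exp (\<delta> * b) * (exp (- \<delta> * b) * B b)
      \<le> exp (\<delta> * b) * (exp (- \<delta> * a) * A + (LINT s:{a..b}|lebesgue. exp (- \<delta> * s) * k s))"
    by (rule mult_left_mono) simp
  also have "\<dots> = exp (\<delta> * b) * (exp (- \<delta> * a) * A)
      + (LINT s:{a..b}|lebesgue. exp (\<delta> * b) * (exp (- \<delta> * s) * k s))"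
    by (simp only: set_integral_mult_right distrib_left)
  finally have "B b \<le> exp (\<delta> * (b - a)) * A + (LINT s:{a..b}|lebesgue. exp (\<delta> * (b - s)) * k s)"
    unfolding shift by simp
  then show ?thesis using le[of b] ab unfolding B_def by simp
qed

section \<open>Bump functions and the fundamental lemma of the calculus of variations\<close>

text \<open>With the elimination rule that follows, derivatives can be given by any explicit family
  \<open>g'\<close>, so the later inductions use the usual differentiation rules instead of
  manipulating \<open>frechet_derivative\<close>.\<close>

lemma Ck_on_SucI:
  assumes "\<And>x. (g has_derivative g' x) (at x)" "\<And>v. Ck_on k (\<lambda>x. g' x v) UNIV"
  shows "Ck_on (Suc k) g UNIV"
proof -
  have "frechet_derivative g (at x) = g' x" for x
    using frechet_derivative_at[OF assms(1)] by simp
  then show ?thesis using assms by (auto simp: differentiable_def)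
qed

lemma Ck_on_SucE:
  assumes "Ck_on (Suc k) g UNIV"
  obtains g' where "\<And>x. (g has_derivative g' x) (at x)" "\<And>v. Ck_on k (\<lambda>x. g' x v) UNIV"
  using assms by (intro that[of "\<lambda>x. frechet_derivative g (at x)"]) (auto simp: frechet_derivative_works)

lemma Ck_on_Suc_imp: "Ck_on (Suc k) g UNIV \<Longrightarrow> Ck_on k g UNIV"
proof (induction k arbitrary: g)
  case 0
  then show ?case
    by (auto intro!: continuous_at_imp_continuous_on differentiable_imp_continuous_within)
next
  case (Suc k)
  then show ?case by simp
qed

lemma Ck_on_const: "Ck_on k (\<lambda>x. c) UNIV"
proof (induction k arbitrary: c)
  case (Suc k)
  show ?case by (rule Ck_on_SucI[of _ "\<lambda>_ _. 0"]) (auto intro: Suc)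
qed simp

lemma Ck_on_linear: "bounded_linear g \<Longrightarrow> Ck_on k g UNIV"
  by (cases k) (auto intro!: Ck_on_SucI[of _ "\<lambda>_. g"] Ck_on_const bounded_linear_imp_has_derivative
      linear_continuous_on simp del: Ck_on.simps(2))

lemma Ck_on_add:
  "Ck_on k f UNIV \<Longrightarrow> Ck_on k g UNIV \<Longrightarrow> Ck_on k (\<lambda>x. f x + g x) UNIV"
proof (induction k arbitrary: f g)
  case (Suc k)
  from Suc.prems obtain f' g' where
    "\<And>x. (f has_derivative f' x) (at x)" "\<And>v. Ck_on k (\<lambda>x. f' x v) UNIV"
    "\<And>x. (g has_derivative g' x) (at x)" "\<And>v. Ck_on k (\<lambda>x. g' x v) UNIV"
    by (metis Ck_on_SucE)
  then show ?case
    by (intro Ck_on_SucI[of _ "\<lambda>x v. f' x v + g' x v"] has_derivative_add Suc.IH)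
qed (simp add: continuous_on_add)

lemma Ck_on_mult:
  "Ck_on k f UNIV \<Longrightarrow> Ck_on k g UNIV \<Longrightarrow> Ck_on k (\<lambda>x. f x * g x) UNIV"
proof (induction k arbitrary: f g)
  case (Suc k)
  from Suc.prems obtain f' g' where
    "\<And>x. (f has_derivative f' x) (at x)" "\<And>v. Ck_on k (\<lambda>x. f' x v) UNIV"
    "\<And>x. (g has_derivative g' x) (at x)" "\<And>v. Ck_on k (\<lambda>x. g' x v) UNIV"
    by (metis Ck_on_SucE)
  \<comment> \<open>The product rule keeps undifferentiated factors in the derivative, so
    \<open>f\<close> and \<open>g\<close> themselves must be available at the lower order.\<close>
  then show ?case using Suc.prems[THEN Ck_on_Suc_imp]
    by (intro Ck_on_SucI[of _ "\<lambda>x v. f x * g' x v + f' x v * g x"] has_derivative_mult Ck_on_add Suc.IH)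
qed (simp add: continuous_on_mult)

lemma smooth_const: "smooth (\<lambda>x. c)"
  by (simp add: smooth_def Ck_on_const)

lemma smooth_add: "smooth f \<Longrightarrow> smooth g \<Longrightarrow> smooth (\<lambda>x. f x + g x)"
  by (simp add: smooth_def Ck_on_add)

lemma smooth_mult: "smooth f \<Longrightarrow> smooth g \<Longrightarrow> smooth (\<lambda>x. f x * g x)"
  by (simp add: smooth_def Ck_on_mult)

lemma smooth_diff: "smooth f \<Longrightarrow> smooth g \<Longrightarrow> smooth (\<lambda>x. f x - g x)"
  using Ck_on_add[OF _ Ck_on_mult[OF Ck_on_const[of _ "-1"]]] by (fastforce simp: smooth_def)

lemma smooth_power: "smooth f \<Longrightarrow> smooth (\<lambda>x. f x ^ n)"
  by (induction n) (auto intro: smooth_const smooth_mult)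

lemma smooth_prod: "(\<And>i::nat. smooth (f i)) \<Longrightarrow> smooth (\<lambda>x. \<Prod>i<n. f i x)"
  by (induction n) (auto intro: smooth_const smooth_mult)

lemma smooth_imp_continuous: "smooth f \<Longrightarrow> continuous_on UNIV f"
  unfolding smooth_def by (metis Ck_on.simps(1))

text \<open>The family is closed under differentiation, which makes smoothness of \<open>exp (-1/y)\<close> an induction.\<close>

definition flat_exp :: "nat \<Rightarrow> real \<Rightarrow> real" where
  "flat_exp m y = (if 0 < y then exp (- 1 / y) / y ^ m else 0)"

lemma power_le_fact_mult_exp:
  fixes x :: real
  assumes "0 \<le> x"
  shows "x ^ n \<le> fact n * exp x"
proof -
  have "(\<lambda>n. x ^ n /\<^sub>R fact n) sums exp x" by (rule exp_converges)
  then have "(\<Sum>i\<in>{n}. x ^ i /\<^sub>R fact i) \<le> exp x"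
    using assms by (intro sum_le_suminf[THEN order.trans[OF _ eq_refl[OF sums_unique[symmetric]]]])
      (auto intro: sums_summable)
  then show ?thesis by (simp add: field_simps)
qed

text \<open>The estimate of a single term of the exponential series, taken at \<open>1 / y\<close>
  with exponent \<open>m + 2\<close>. Two powers of \<open>y\<close> are saved because the
  difference quotient at \<open>0\<close> uses up one and the other sends it to
  \<open>0\<close>.\<close>

lemma flat_exp_le: "\<bar>flat_exp m y\<bar> \<le> fact (m + 2) * y\<^sup>2"
proof (cases "0 < y")
  case True
  have "(1 / y) ^ (m + 2) \<le> fact (m + 2) * exp (1 / y)"
    using True by (intro power_le_fact_mult_exp) simp
  then have "(1 / y) ^ (m + 2) * exp (- 1 / y) * y\<^sup>2 \<le> fact (m + 2) * exp (1 / y) * exp (- 1 / y) * y\<^sup>2"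
    by (intro mult_right_mono) auto
  also have "\<dots> = fact (m + 2) * y\<^sup>2"
    by (simp add: mult.assoc flip: exp_add)
  also have "(1 / y) ^ (m + 2) * exp (- 1 / y) * y\<^sup>2 = flat_exp m y"
    using True by (simp add: flat_exp_def power_add power2_eq_square field_simps)
  finally show ?thesis using True by (simp add: flat_exp_def)
qed (simp add: flat_exp_def)

lemma has_derivative_flat_exp:
  "(flat_exp m has_real_derivative flat_exp (m + 2) y - real m * flat_exp (m + 1) y) (at y)"
proof -
  consider "0 < y" | "y < 0" | "y = 0" by linarith
  then show ?thesis
  proof cases
    case 1
    have "((\<lambda>y. exp (- 1 / y) / y ^ m) has_real_derivative
        (exp (- 1 / y) * (1 / y\<^sup>2) * y ^ m - exp (- 1 / y) * (real m * y ^ (m - 1))) / (y ^ m * y ^ m)) (at y)"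
      using 1 by (auto intro!: derivative_eq_intros simp: power2_eq_square)
    also have "(exp (- 1 / y) * (1 / y\<^sup>2) * y ^ m - exp (- 1 / y) * (real m * y ^ (m - 1))) / (y ^ m * y ^ m)
        = flat_exp (m + 2) y - real m * flat_exp (m + 1) y"
      using 1 by (cases m) (simp_all add: flat_exp_def power_add field_simps power2_eq_square)
    finally show ?thesis
      by (rule has_field_derivative_transform_within_open[of _ _ _ "{0<..}"]) (use 1 in \<open>auto simp: flat_exp_def\<close>)
  next
    case 2
    have "((\<lambda>_. 0) has_real_derivative 0) (at y)" by simp
    then have "(flat_exp m has_real_derivative 0) (at y)"
      by (rule has_field_derivative_transform_within_open[of _ _ _ "{..<0}"]) (use 2 in \<open>auto simp: flat_exp_def\<close>)
    then show ?thesis using 2 by (simp add: flat_exp_def)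
  next
    case 3
    have "((\<lambda>h. flat_exp m h / h) \<longlongrightarrow> 0) (at 0)"
    proof (rule Lim_null_comparison)
      show "\<forall>\<^sub>F h in at 0. norm (flat_exp m h / h) \<le> fact (m + 2) * \<bar>h\<bar>"
        using flat_exp_le[of m] by (intro always_eventually) (auto simp: divide_le_eq power2_eq_square mult.assoc)
      show "((\<lambda>h. fact (m + 2) * \<bar>h\<bar> :: real) \<longlongrightarrow> 0) (at 0)"
        by (auto intro!: tendsto_eq_intros)
    qed
    then show ?thesis using 3 by (simp add: DERIV_def flat_exp_def)
  qed
qed

text \<open>The induction is over all \<open>m\<close> at once: differentiating index
  \<open>m\<close> produces the indices \<open>m + 1\<close> and \<open>m + 2\<close>, times a
  derivative of \<open>q\<close> by the chain rule.\<close>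

lemma Ck_on_flat_exp:
  fixes q :: "'a::real_normed_vector \<Rightarrow> real"
  assumes "smooth q"
  shows "Ck_on k (\<lambda>x. flat_exp m (q x)) UNIV"
proof (induction k arbitrary: m)
  case 0
  have "continuous_on UNIV (flat_exp m)"
    by (intro continuous_at_imp_continuous_on ballI DERIV_isCont[OF has_derivative_flat_exp])
  then show ?case using smooth_imp_continuous[OF assms]
    by (auto intro: continuous_on_compose2)
next
  case (Suc k)
  from assms have "Ck_on (Suc k) q UNIV" by (simp add: smooth_def)
  then obtain q' where q': "\<And>x. (q has_derivative q' x) (at x)" "\<And>v. Ck_on k (\<lambda>x. q' x v) UNIV"
    by (metis Ck_on_SucE)
  show ?case
  proof (rule Ck_on_SucI)
    show "((\<lambda>x. flat_exp m (q x)) has_derivative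
        (\<lambda>v. (flat_exp (m + 2) (q x) + (- real m) * flat_exp (m + 1) (q x)) * q' x v)) (at x)" for x
      using has_derivative_compose[OF q'(1)[of x] has_derivative_flat_exp[unfolded has_field_derivative_def]]
      by simp
    show "Ck_on k (\<lambda>x. (flat_exp (m + 2) (q x) + (- real m) * flat_exp (m + 1) (q x)) * q' x v) UNIV" for v
      by (intro Ck_on_mult Ck_on_add Ck_on_const Suc q'(2))
  qed
qed

text \<open>The standard bump \<open>exp (-1 / (\<rho>\<^sup>2 - (dist x c)\<^sup>2))\<close>,
  extended by zero outside the ball. The squared distance makes the argument a polynomial in the
  coordinates, hence smooth at the centre too.\<close>

definition bump :: "'a::euclidean_space \<Rightarrow> real \<Rightarrow> 'a \<Rightarrow> real" where
  "bump c \<rho> x = flat_exp 0 (\<rho>\<^sup>2 - (dist x c)\<^sup>2)"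

lemma smooth_bump: "smooth (bump c \<rho>)"
proof -
  have lin: "smooth (\<lambda>x::'a. inner x b)" for b
    by (simp add: smooth_def Ck_on_linear bounded_linear_inner_left)
  have "smooth (\<lambda>x::'a. \<Sum>b\<in>Basis. (inner x b - inner c b) * (inner x b - inner c b))"
    using finite_Basis
  proof (induction rule: finite_induct)
    case (insert b B)
    then show ?case
      by (simp add: smooth_add smooth_mult smooth_diff smooth_const lin)
  qed (simp add: smooth_const)
  moreover have "(dist x c)\<^sup>2 = (\<Sum>b\<in>Basis. (inner x b - inner c b) * (inner x b - inner c b))" for x
    unfolding dist_norm power2_norm_eq_inner by (subst euclidean_inner) (simp add: inner_diff_left)
  ultimately have "smooth (\<lambda>x. \<rho>\<^sup>2 - (dist x c)\<^sup>2)"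
    by (auto intro: smooth_diff smooth_const)
  then show ?thesis unfolding bump_def[abs_def] smooth_def by (metis Ck_on_flat_exp smooth_def)
qed

lemma bump_range: "0 \<le> bump c \<rho> x" "bump c \<rho> x < 1"
  by (auto simp: bump_def flat_exp_def)

lemma bump_pos_iff: "0 \<le> \<rho> \<Longrightarrow> 0 < bump c \<rho> x \<longleftrightarrow> x \<in> ball c \<rho>"
  by (auto simp: bump_def flat_exp_def dist_commute power2_less_imp_less intro: power_strict_mono)

lemma bump_eq_0: "0 \<le> \<rho> \<Longrightarrow> x \<notin> ball c \<rho> \<Longrightarrow> bump c \<rho> x = 0"
  using bump_pos_iff bump_range(1)[of c \<rho> x] by (metis order.order_iff_strict)

section \<open>From test functions to open sets, Borel sets and Lebesgue sets\<close>

text \<open>Exhaust \<open>U\<close> by countably many balls whose closures lie in \<open>U\<close>.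
  Off \<open>U\<close> all bumps vanish; at a point of \<open>U\<close> some bump is positive, and
  raising its complement to growing powers drives a product to \<open>0\<close>.\<close>

lemma test_functions_approx_indicator:
  fixes U :: "'a::euclidean_space set"
  assumes "open U" "U \<subseteq> \<Omega>"
  obtains \<psi> :: "nat \<Rightarrow> 'a \<Rightarrow> real" where "\<And>n. test_function \<Omega> (\<psi> n)"
    "\<And>n x. 0 \<le> \<psi> n x \<and> \<psi> n x \<le> 1" "\<And>x. (\<lambda>n. \<psi> n x) \<longlonglongrightarrow> indicator U x"
proof (cases "U = {}")
  case True
  have "test_function \<Omega> (\<lambda>x. 0)" by (simp add: test_function_def smooth_const)
  then show ?thesis using that[of "\<lambda>_ _. 0"] True by simp
next
  case False
  obtain F where F: "F \<subseteq> {ball x e |x e. 0 < e \<and> cball x e \<subseteq> U}" "countable F"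
    "\<Union>F = \<Union>{ball x e |x e. 0 < e \<and> cball x e \<subseteq> U}"
    by (rule Lindelof[of "{ball x e |x e. 0 < e \<and> cball x e \<subseteq> U}"]) auto
  have U: "\<Union>F = U"
    unfolding F(3)
  proof (intro subset_antisym subsetI)
    fix x assume "x \<in> U"
    then obtain e where "0 < e" "cball x e \<subseteq> U"
      using assms(1) open_contains_cball by blast
    then show "x \<in> \<Union>{ball x e |x e. 0 < e \<and> cball x e \<subseteq> U}"
      by (auto intro!: exI[of _ "ball x e"])
  next
    fix x assume "x \<in> \<Union>{ball x e |x e. 0 < e \<and> cball x e \<subseteq> U}"
    then show "x \<in> U" using ball_subset_cball by fastforce
  qed
  with False have "F \<noteq> {}" by auto
  then have "\<exists>x e. 0 < e \<and> cball x e \<subseteq> U \<and> from_nat_into F i = ball x e" for i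
    using F(1) from_nat_into[of F i] by blast
  then obtain c \<rho> where c: "\<And>i. 0 < \<rho> i" "\<And>i. cball (c i) (\<rho> i) \<subseteq> U"
    "\<And>i. from_nat_into F i = ball (c i) (\<rho> i)" by metis
  have Ueq: "U = (\<Union>i. ball (c i) (\<rho> i))"
    using U range_from_nat_into[OF \<open>F \<noteq> {}\<close> F(2)] c(3) by (metis (no_types, lifting) SUP_cong)
  \<comment> \<open>The index \<open>n\<close> has two roles: as the number of factors it keeps the
    support inside finitely many closed balls, hence compact in \<open>U\<close>; as the exponent it
    forces convergence to \<open>1\<close> on \<open>U\<close>.\<close>
  define \<psi> where "\<psi> n x = 1 - (\<Prod>i<n. (1 - bump (c i) (\<rho> i) x) ^ n)" for n x
  have factor: "0 \<le> (1 - bump (c i) (\<rho> i) x) ^ n" "(1 - bump (c i) (\<rho> i) x) ^ n \<le> 1" for i n x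
    using bump_range[of "c i" "\<rho> i" x] by (auto intro: power_le_one)
  show ?thesis
  proof (rule that[of \<psi>])
    fix n x
    show "0 \<le> \<psi> n x \<and> \<psi> n x \<le> 1"
      unfolding \<psi>_def using factor by (auto intro: prod_nonneg prod_le_1)
  next
    fix n
    have "smooth (\<psi> n)"
      unfolding \<psi>_def[abs_def] by (intro smooth_diff smooth_const smooth_prod smooth_power smooth_bump)
    moreover have "{x. \<psi> n x \<noteq> 0} \<subseteq> (\<Union>i<n. cball (c i) (\<rho> i))"
    proof
      fix x assume "x \<in> {x. \<psi> n x \<noteq> 0}"
      then obtain i where "i < n" "bump (c i) (\<rho> i) x \<noteq> 0"
        unfolding \<psi>_def by (cases "\<forall>i<n. bump (c i) (\<rho> i) x = 0") auto
      then show "x \<in> (\<Union>i<n. cball (c i) (\<rho> i))"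
        using bump_eq_0[of "\<rho> i" x "c i"] c(1)[of i] by fastforce
    qed
    moreover have K: "compact (\<Union>i<n. cball (c i) (\<rho> i))" by (intro compact_UN) auto
    ultimately have "closure {x. \<psi> n x \<noteq> 0} \<subseteq> (\<Union>i<n. cball (c i) (\<rho> i))" "smooth (\<psi> n)"
      by (auto intro: closure_minimal[THEN subsetD] compact_imp_closed)
    then show "test_function \<Omega> (\<psi> n)"
      unfolding test_function_def using c(2) assms(2) compact_Int_closed[OF K closed_closure]
      by (metis (no_types, lifting) SUP_least inf.absorb_iff2 order.trans)
  next
    fix x
    show "(\<lambda>n. \<psi> n x) \<longlonglongrightarrow> indicator U x"
    proof (cases "x \<in> U")
      case False
      then have "bump (c i) (\<rho> i) x = 0" for i
        using c by (intro bump_eq_0) (auto simp: Ueq less_imp_le)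
      then show ?thesis using False by (simp add: \<psi>_def)
    next
      case True
      then obtain i where i: "x \<in> ball (c i) (\<rho> i)" by (auto simp: Ueq)
      define q where "q = 1 - bump (c i) (\<rho> i) x"
      have q: "0 \<le> q" "q < 1"
        using i c(1)[of i] bump_pos_iff[of "\<rho> i" "c i" x] bump_range[of "c i" "\<rho> i" x] by (auto simp: q_def)
      have "(\<lambda>n. \<Prod>i<n. (1 - bump (c i) (\<rho> i) x) ^ n) \<longlonglongrightarrow> 0"
      proof (rule tendsto_sandwich[OF _ _ tendsto_const])
        show "(\<lambda>n. q ^ n) \<longlonglongrightarrow> 0" using q by (intro LIMSEQ_power_zero) auto
        \<comment> \<open>Once \<open>n\<close> exceeds \<open>i\<close>, the ball containing
          \<open>x\<close> contributes the factor \<open>q ^ n\<close>, and all other factors are at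
          most \<open>1\<close>.\<close>
        show "\<forall>\<^sub>F n in sequentially. (\<Prod>i<n. (1 - bump (c i) (\<rho> i) x) ^ n) \<le> q ^ n"
          using eventually_gt_at_top[of i]
        proof eventually_elim
          case (elim n)
          have "(\<Prod>i<n. (1 - bump (c i) (\<rho> i) x) ^ n)
              = q ^ n * (\<Prod>i\<in>{..<n} - {i}. (1 - bump (c i) (\<rho> i) x) ^ n)"
            using elim by (simp add: prod.remove[of _ i] q_def)
          also have "\<dots> \<le> q ^ n * 1"
            using factor q by (intro mult_left_mono prod_le_1) auto
          finally show ?case by simp
        qed
        show "\<forall>\<^sub>F n in sequentially. 0 \<le> (\<Prod>i<n. (1 - bump (c i) (\<rho> i) x) ^ n)"
          using factor by (intro always_eventually allI prod_nonneg) auto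
      qed
      from tendsto_diff[OF tendsto_const[of 1] this] show ?thesis
        using True by (simp add: \<psi>_def)
    qed
  qed
qed

text \<open>Open sets form an intersection-stable generator of the Borel sets, so Dynkin's argument
  extends the vanishing to Borel sets. Completion adds only null sets, and a density with all
  integrals zero is zero almost everywhere.\<close>

lemma AE_eq_0_if_open_integrals_0:
  fixes g :: "'a::euclidean_space \<Rightarrow> real"
  assumes g: "integrable lebesgue g" and 0: "\<And>U. open U \<Longrightarrow> (LINT x:U|lebesgue. g x) = 0"
  shows "AE x in lebesgue. g x = 0"
proof (rule density_unique_real[OF g, of "\<lambda>_. 0"])
  have int: "set_integrable lebesgue A g" if "A \<in> sets lebesgue" for A
    using integrable_mult_indicator[OF that g] by (simp add: set_integrable_def)
  have "Int_stable {S::'a set. open S}" "{S::'a set. open S} \<subseteq> Pow UNIV"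
    by (auto simp: Int_stable_def)
  then have borel: "(LINT x:A|lebesgue. g x) = 0" if "A \<in> sets borel" for A
    using that[unfolded sets_borel]
  proof (induction rule: sigma_sets_induct_disjoint)
    case (compl A)
    then have A: "A \<in> sets lebesgue" by (simp flip: sets_borel)
    have "(LINT x:A \<union> (UNIV - A)|lebesgue. g x) = (LINT x:A|lebesgue. g x) + (LINT x:UNIV - A|lebesgue. g x)"
      by (rule set_integral_Un) (use A in \<open>auto intro!: int sets.Diff\<close>)
    then show ?case using compl 0[of UNIV] by simp
  next
    case (union A)
    then have "A i \<in> sets lebesgue" for i
      by (metis sets_borel range_subsetD sets_completionI_sets sets_lborel)
    then show ?case
      using union(1,3) by (subst lebesgue_integral_countable_add)
        (auto simp: disjoint_family_on_def intro!: int)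
  qed (use 0 in auto)
  fix A :: "'a set" assume "A \<in> sets lebesgue"
  then obtain S N N' where S: "A = S \<union> N" "N \<subseteq> N'" "N' \<in> null_sets lborel" "S \<in> sets lborel"
    by (rule sets_completionE)
  have "AE x in lebesgue. x \<notin> N'"
    using S(3) by (intro AE_not_in) (simp add: null_sets_completionI)
  then have "AE x in lebesgue. indicator A x *\<^sub>R g x = indicator S x *\<^sub>R g x"
    by eventually_elim (use S in \<open>auto simp: indicator_def\<close>)
  then have "(LINT x:A|lebesgue. g x) = (LINT x:S|lebesgue. g x)"
    unfolding set_lebesgue_integral_def using \<open>A \<in> _\<close> S(4) g
    by (intro integral_cong_AE borel_measurable_scaleR borel_measurable_indicator) auto
  then show "(LINT x:A|lebesgue. g x) = (LINT x:A|lebesgue. 0)"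
    using borel S(4) by simp
qed simp

text \<open>Extend \<open>g\<close> by zero to \<open>h\<close>. Test functions converging boundedly
  to the indicator of \<open>U \<inter> \<Omega>\<close> pass the hypothesis on to every open
  \<open>U\<close>, by dominated convergence with majorant \<open>\<bar>h\<bar>\<close>.\<close>

lemma fundamental_lemma_of_variations:
  fixes g :: "'a::euclidean_space \<Rightarrow> real"
  assumes "open \<Omega>" and g: "set_integrable lebesgue \<Omega> g"
    and 0: "\<And>\<psi>. test_function \<Omega> \<psi> \<Longrightarrow> (LINT x:\<Omega>|lebesgue. g x * \<psi> x) = 0"
  shows "AE x in lebesgue. x \<in> \<Omega> \<longrightarrow> g x = 0"
proof -
  define h where "h x = indicator \<Omega> x * g x" for x
  have h: "integrable lebesgue h" using g by (simp add: set_integrable_def h_def[abs_def])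
  have "AE x in lebesgue. h x = 0"
  proof (rule AE_eq_0_if_open_integrals_0[OF h])
    fix U :: "'a set" assume U: "open U"
    obtain \<psi> :: "nat \<Rightarrow> 'a \<Rightarrow> real" where \<psi>: "\<And>n. test_function \<Omega> (\<psi> n)"
      "\<And>n x. 0 \<le> \<psi> n x \<and> \<psi> n x \<le> 1" "\<And>x. (\<lambda>n. \<psi> n x) \<longlonglongrightarrow> indicator (U \<inter> \<Omega>) x"
      using test_functions_approx_indicator[of "U \<inter> \<Omega>" \<Omega>] U assms(1) by blast
    have "(\<lambda>n. LINT x|lebesgue. h x * \<psi> n x) \<longlonglongrightarrow> (LINT x|lebesgue. h x * indicator (U \<inter> \<Omega>) x)"
    proof (rule integral_dominated_convergence[where w = "\<lambda>x. \<bar>h x\<bar>"])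
      show "AE x in lebesgue. (\<lambda>n. h x * \<psi> n x) \<longlonglongrightarrow> h x * indicator (U \<inter> \<Omega>) x"
        by (intro AE_I2 tendsto_mult_left \<psi>(3))
      show "AE x in lebesgue. norm (h x * \<psi> n x) \<le> \<bar>h x\<bar>" for n
        using \<psi>(2) by (intro AE_I2) (simp add: abs_mult mult_left_le)
      have "\<psi> n \<in> borel_measurable lebesgue" for n
        using \<psi>(1)[of n] borel_measurable_continuous_onI[OF smooth_imp_continuous, of "\<psi> n"]
        by (auto simp: test_function_def intro: measurable_completion)
      then show "(\<lambda>x. h x * \<psi> n x) \<in> borel_measurable lebesgue" for n
        using h by auto
      show "(\<lambda>x. h x * indicator (U \<inter> \<Omega>) x) \<in> borel_measurable lebesgue"
        using h U assms(1) by (auto intro!: borel_measurable_times borel_measurable_indicator)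
    qed (use h in auto)
    moreover have "(LINT x|lebesgue. h x * \<psi> n x) = 0" for n
      using 0[OF \<psi>(1)[of n]] by (simp add: set_lebesgue_integral_def h_def mult.assoc)
    ultimately have "(LINT x|lebesgue. h x * indicator (U \<inter> \<Omega>) x) = 0"
      by (simp add: LIMSEQ_const_iff)
    also have "(\<lambda>x. h x * indicator (U \<inter> \<Omega>) x) = (\<lambda>x. indicator U x *\<^sub>R h x)"
      by (auto simp: h_def indicator_def)
    finally show "(LINT x:U|lebesgue. h x) = 0" by (simp add: set_lebesgue_integral_def)
  qed
  then show ?thesis by eventually_elim (auto simp: h_def)
qed

section \<open>Restriction of weak solutions in time\<close>

lemma cont_into_subset: "cont_into X nX I u \<Longrightarrow> J \<subseteq> I \<Longrightarrow> cont_into X nX J u"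
  unfolding cont_into_def by (meson subsetD tendsto_within_subset)

lemma AE_lebesgue_on_subset:
  assumes "AE x in lebesgue_on I. P x" "J \<subseteq> I" "I \<in> sets lebesgue" "J \<in> sets lebesgue"
  shows "AE x in lebesgue_on J. P x"
proof -
  have "AE x in lebesgue. x \<in> I \<longrightarrow> P x"
    using assms by (simp add: AE_restrict_space_iff)
  then have "AE x in lebesgue. x \<in> J \<longrightarrow> P x"
    by eventually_elim (use assms(2) in auto)
  then show ?thesis using assms by (simp add: AE_restrict_space_iff)
qed

lemma strongly_measurable_into_subset:
  assumes "strongly_measurable_into X nX I u" and J: "J \<subseteq> I" "I \<in> sets lebesgue" "J \<in> sets lebesgue"
  shows "strongly_measurable_into X nX J u"
proof -
  obtain s where s: "\<And>k::nat. simple_function (lebesgue_on I) (s k)" "\<And>k. s k ` I \<subseteq> X"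
    and ae: "AE t in lebesgue_on I. u t \<in> X \<and> (\<lambda>k. nX (s k t - u t)) \<longlonglongrightarrow> 0"
    using assms(1) unfolding strongly_measurable_into_def by blast
  have "simple_function (lebesgue_on J) (s k)" for k
    unfolding simple_function_def
  proof (intro conjI ballI)
    have "finite (s k ` I)" using simple_functionD(1)[OF s(1)[of k]] by simp
    then show "finite (s k ` space (lebesgue_on J))"
      by (rule finite_subset[rotated]) (use J(1) in auto)
    fix x
    have "s k -` {x} \<inter> I \<in> sets (lebesgue_on I)"
      using simple_functionD(2)[OF s(1)[of k], of "{x}"] by simp
    then have "s k -` {x} \<inter> I \<in> sets lebesgue"
      using J(2) by (simp add: sets_restrict_space_iff)
    then have "s k -` {x} \<inter> I \<inter> J \<in> sets lebesgue" using J(3) by (rule sets.Int)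
    moreover have "s k -` {x} \<inter> I \<inter> J = s k -` {x} \<inter> J" using J(1) by auto
    ultimately show "s k -` {x} \<inter> space (lebesgue_on J) \<in> sets (lebesgue_on J)"
      using J(3) by (simp add: sets_restrict_space_iff)
  qed
  then show ?thesis
    unfolding strongly_measurable_into_def using s(2) J(1) AE_lebesgue_on_subset[OF ae J]
    by (intro exI[of _ s]) blast
qed

lemma Linf_into_subset:
  "Linf_into X nX I u \<Longrightarrow> J \<subseteq> I \<Longrightarrow> I \<in> sets lebesgue \<Longrightarrow> J \<in> sets lebesgue \<Longrightarrow> Linf_into X nX J u"
  unfolding Linf_into_def by (metis AE_lebesgue_on_subset strongly_measurable_into_subset)

lemma L2_into_subset:
  assumes "L2_into X nX I u" and J: "J \<subseteq> I" "I \<in> sets lebesgue" "J \<in> sets lebesgue"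
  shows "L2_into X nX J u"
proof -
  have "set_integrable lebesgue I (\<lambda>t. (nX (u t))\<^sup>2)"
    using assms by (simp add: L2_into_def set_integrable_def integrable_restrict_space)
  then have "set_integrable lebesgue J (\<lambda>t. (nX (u t))\<^sup>2)"
    by (rule set_integrable_subset) (use J in auto)
  then show ?thesis
    using assms strongly_measurable_into_subset[OF _ J]
    by (auto simp: L2_into_def set_integrable_def integrable_restrict_space)
qed

lemma test_function_mono: "test_function I \<psi> \<Longrightarrow> I \<subseteq> J \<Longrightarrow> test_function J \<psi>"
  unfolding test_function_def by blast

lemma test_function_vanishes:
  fixes \<psi> :: "real \<Rightarrow> real"
  assumes "test_function I \<psi>" "t \<notin> I"
  shows "\<psi> t = 0" "deriv \<psi> t = 0"
proof -
  let ?K = "closure {x. \<psi> x \<noteq> 0}"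
  have t: "t \<in> - ?K" using assms by (auto simp: test_function_def)
  have 0: "\<psi> x = 0" if "x \<in> - ?K" for x using that closure_subset[of "{x. \<psi> x \<noteq> 0}"] by auto
  show "\<psi> t = 0" by (rule 0[OF t])
  \<comment> \<open>The complement of the closed support is open, so the function vanishes in a
    whole neighbourhood of \<open>t\<close>.\<close>
  have "(\<psi> has_real_derivative 0) (at t)"
  proof (rule has_field_derivative_transform_within_open)
    show "((\<lambda>_. 0) has_real_derivative 0) (at t)" by simp
    show "open (- ?K)" by (rule open_Compl[OF closed_closure])
    show "0 = \<psi> x" if "x \<in> - ?K" for x using 0[OF that] by simp
  qed (rule t)
  then show "deriv \<psi> t = 0" by (rule DERIV_imp_deriv)
qed

lemma set_integral_test_function_mono:
  fixes \<psi> :: "real \<Rightarrow> real" and g :: "real \<Rightarrow> real"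
  assumes "test_function I \<psi>" "I \<subseteq> J"
  shows "(LINT t:J|lebesgue. g t * \<psi> t) = (LINT t:I|lebesgue. g t * \<psi> t)"
    "(LINT t:J|lebesgue. g t * deriv \<psi> t) = (LINT t:I|lebesgue. g t * deriv \<psi> t)"
  unfolding set_lebesgue_integral_def using assms test_function_vanishes[OF assms(1)]
  by (auto intro!: Bochner_Integration.integral_cong simp: indicator_def)

text \<open>Every test function on the shorter interval is one on the longer, and it vanishes with
  its derivative outside the shorter one, so the distributional identities coincide. The same
  \<open>w\<close> is the second derivative.\<close>

lemma weak_solution_restrict:
  assumes "weak_solution \<Omega> lam r f G h \<tau> T \<phi> u v" "S \<le> T"
  shows "weak_solution \<Omega> lam r f G h \<tau> S \<phi> u v"
proof -
  have sub: "{\<tau>-r..S} \<subseteq> {\<tau>-r..T}" "{\<tau><..<S} \<subseteq> {\<tau><..<T}" using assms(2) by auto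
  have sets: "{\<tau><..<T} \<in> sets lebesgue" "{\<tau><..<S} \<in> sets lebesgue" by auto
  note tf = test_function_mono[OF _ sub(2)]
  note int = set_integral_test_function_mono[OF _ sub(2)]
  from assms(1) obtain w where
    w: "L2_into (V_dual \<Omega>) (V_dual_norm \<Omega>) {\<tau><..<T} w"
    "\<And>x \<psi>. x \<in> V \<Omega> \<Longrightarrow> test_function {\<tau><..<T} \<psi> \<Longrightarrow>
           (LINT t:{\<tau><..<T}|lebesgue. inner (v t) x * deriv \<psi> t)
             = - (LINT t:{\<tau><..<T}|lebesgue. w t x * \<psi> t)"
    "\<And>x. x \<in> V \<Omega> \<Longrightarrow> AE t in lebesgue_on {\<tau><..<T}.
           w t x + grad_inner \<Omega> (v t) x + inner (Laplacian \<Omega> (u t)) (Laplacian \<Omega> x)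
             + lam * inner (u t) x + inner (nemytskii f (u t)) x
           = inner (G t (history r u t)) x + inner (h t) x"
    unfolding weak_solution_def by blast
  show ?thesis
    unfolding weak_solution_def
  proof (intro conjI ballI allI impI exI[of _ w])
    fix x \<psi> assume x: "x \<in> L2 \<Omega>" and \<psi>: "test_function {\<tau><..<S} \<psi>"
    have "(LINT t:{\<tau><..<T}|lebesgue. inner (u t) x * deriv \<psi> t)
          = - (LINT t:{\<tau><..<T}|lebesgue. inner (v t) x * \<psi> t)"
      using assms(1) x tf[OF \<psi>] unfolding weak_solution_def by blast
    then show "(LINT t:{\<tau><..<S}|lebesgue. inner (u t) x * deriv \<psi> t)
          = - (LINT t:{\<tau><..<S}|lebesgue. inner (v t) x * \<psi> t)"
      unfolding int[OF \<psi>] .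
  next
    fix x \<psi> assume x: "x \<in> V \<Omega>" and \<psi>: "test_function {\<tau><..<S} \<psi>"
    show "(LINT t:{\<tau><..<S}|lebesgue. inner (v t) x * deriv \<psi> t)
             = - (LINT t:{\<tau><..<S}|lebesgue. w t x * \<psi> t)"
      using w(2)[OF x tf[OF \<psi>]] unfolding int[OF \<psi>] .
  next
    fix x assume x: "x \<in> V \<Omega>"
    show "AE t in lebesgue_on {\<tau><..<S}.
           w t x + grad_inner \<Omega> (v t) x + inner (Laplacian \<Omega> (u t)) (Laplacian \<Omega> x)
             + lam * inner (u t) x + inner (nemytskii f (u t)) x
           = inner (G t (history r u t)) x + inner (h t) x"
      by (rule AE_lebesgue_on_subset[OF w(3)[OF x] sub(2) sets])
  next
    show "L2_into (V_dual \<Omega>) (V_dual_norm \<Omega>) {\<tau><..<S} w"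
      by (rule L2_into_subset[OF w(1) sub(2) sets])
  qed (use assms(1) sub sets in \<open>auto simp: weak_solution_def
      intro: cont_into_subset continuous_on_subset Linf_into_subset L2_into_subset\<close>)
qed

lemma process_eq:
  assumes wp: "well_posed \<Omega> lam r f G h" and \<phi>: "\<phi> \<in> Hc \<Omega> r" and "\<tau> \<le> t"
    and sol: "weak_solution \<Omega> lam r f G h \<tau> T \<phi> u v" and "t < T"
  shows "process \<Omega> lam r f G h t \<tau> \<phi> = (history r u t, history r v t)"
  unfolding process_def
proof (rule the_equality)
  show "\<exists>T u' v'. t < T \<and> weak_solution \<Omega> lam r f G h \<tau> T \<phi> u' v' \<and>
      (history r u t, history r v t) = (history r u' t, history r v' t)"
    using assms by blast
  fix \<xi> assume "\<exists>T u v. t < T \<and> weak_solution \<Omega> lam r f G h \<tau> T \<phi> u v \<and> \<xi> = (history r u t, history r v t)"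
  then obtain T' u' v' where sol': "t < T'" "weak_solution \<Omega> lam r f G h \<tau> T' \<phi> u' v'"
    "\<xi> = (history r u' t, history r v' t)" by blast
  \<comment> \<open>Uniqueness compares solutions with the same final time, so both are cut to the
    common interval. The strict \<open>t < T\<close> in \<open>process\<close> guarantees
    \<open>\<tau> < S\<close> even when \<open>t = \<tau>\<close>.\<close>
  define S where "S = min T T'"
  have S: "\<tau> < S" "t < S" using assms sol' by (auto simp: S_def)
  have "weak_solution \<Omega> lam r f G h \<tau> S \<phi> u v" "weak_solution \<Omega> lam r f G h \<tau> S \<phi> u' v'"
    using sol sol' by (auto intro: weak_solution_restrict simp: S_def)
  with wp \<phi> S(1) have eq: "\<forall>s\<in>{\<tau>-r..S}. u' s = u s \<and> v' s = v s"
    unfolding well_posed_def by metis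
  have "u' (t + \<theta>) = u (t + \<theta>) \<and> v' (t + \<theta>) = v (t + \<theta>)" if "\<theta> \<in> {-r..0}" for \<theta>
    using eq[rule_format, of "t + \<theta>"] that S \<open>\<tau> \<le> t\<close> by auto
  then show "\<xi> = (history r u t, history r v t)"
    unfolding sol'(3) history_def by (auto intro!: restrict_ext)
qed

section \<open>The zero history\<close>

lemma square_integrable_rep_l2: "square_integrable (rep_l2 u)"
  using Quotient_rep_reflp[OF Quotient_l2] by blast

lemma l2_eqI: "AE x in lebesgue. rep_l2 u x = rep_l2 v x \<Longrightarrow> u = v"
  using Quotient_rel_rep[OF Quotient_l2] square_integrable_rep_l2 by blast

lemma rep_l2_0: "AE x in lebesgue. rep_l2 (0 :: 'a::euclidean_space l2) x = 0"
  using Quotient_rep_abs[OF Quotient_l2, of "\<lambda>_::'a. 0"] square_integrable_0[where 'a = 'a]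
  unfolding zero_l2_def by simp

lemma zero_in_L2: "0 \<in> L2 \<Omega>"
  unfolding L2_def using rep_l2_0 by (auto elim: AE_mp)

lemma set_integral_rep_l2_0: "(LINT x:\<Omega>|lebesgue. rep_l2 0 x * g x) = 0"
  unfolding set_lebesgue_integral_def
  by (rule integral_eq_zero_AE, rule AE_mp[OF rep_l2_0]) auto

lemma weak_partial_0: "weak_partial \<Omega> b 0 0"
  by (simp add: weak_partial_def set_integral_rep_l2_0)

text \<open>A weak derivative of zero annihilates all test functions, hence vanishes almost
  everywhere in \<open>\<Omega>\<close>; membership in \<open>L2 \<Omega>\<close> makes it vanish
  outside.\<close>

lemma partial_0:
  assumes "open \<Omega>" "bounded \<Omega>"
  shows "partial \<Omega> b 0 = 0"
  unfolding partial_def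
proof (rule the_equality)
  show "0 \<in> L2 \<Omega> \<and> weak_partial \<Omega> b 0 0" by (simp add: zero_in_L2 weak_partial_0)
next
  fix g assume g: "g \<in> L2 \<Omega> \<and> weak_partial \<Omega> b 0 g"
  \<comment> \<open>Boundedness makes the indicator of \<open>\<Omega>\<close> square integrable, so
    its product with \<open>g\<close> is integrable, as the fundamental lemma requires.\<close>
  have "\<Omega> \<in> lmeasurable" using assms by (intro lmeasurable_open)
  moreover have "(\<lambda>x. (indicator \<Omega> x :: real)\<^sup>2) = indicator \<Omega>" by (auto simp: indicator_def)
  ultimately have "square_integrable (indicator \<Omega>)"
    by (auto simp: square_integrable_def fmeasurable_def)
  from square_integrable_mult[OF this square_integrable_rep_l2[of g]]
  have "set_integrable lebesgue \<Omega> (rep_l2 g)" by (simp add: set_integrable_def)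
  moreover have "(LINT x:\<Omega>|lebesgue. rep_l2 g x * \<psi> x) = 0" if "test_function \<Omega> \<psi>" for \<psi>
    using g that by (auto simp: weak_partial_def set_integral_rep_l2_0)
  ultimately have "AE x in lebesgue. x \<in> \<Omega> \<longrightarrow> rep_l2 g x = 0"
    by (rule fundamental_lemma_of_variations[OF assms(1)])
  moreover have "AE x in lebesgue. x \<notin> \<Omega> \<longrightarrow> rep_l2 g x = 0"
    using g by (simp add: L2_def)
  ultimately have "AE x in lebesgue. rep_l2 g x = rep_l2 0 x"
    using rep_l2_0 by eventually_elim auto
  then show "g = 0" by (rule l2_eqI)
qed

lemma Laplacian_0: "open \<Omega> \<Longrightarrow> bounded \<Omega> \<Longrightarrow> Laplacian \<Omega> 0 = 0"
  by (simp add: Laplacian_def partial_0)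

lemma zero_in_V:
  assumes "open \<Omega>" "bounded \<Omega>"
  shows "0 \<in> V \<Omega>"
proof -
  have H1: "0 \<in> H1 \<Omega>" using zero_in_L2 weak_partial_0 by (auto simp: H1_def)
  have "test_function \<Omega> (\<lambda>_. 0)" by (simp add: test_function_def smooth_const)
  moreover have "H1_norm \<Omega> (0 - abs_l2 (\<lambda>_. 0)) = 0"
    using partial_0[OF assms] by (simp add: H1_norm_def grad_inner_def zero_l2_def[symmetric])
  ultimately show ?thesis
    using H1 partial_0[OF assms] by (auto simp: V_def H2_def H10_def)
qed

definition zero_history :: "real \<Rightarrow> 'a::euclidean_space hist" where
  "zero_history r = (restrict (\<lambda>_. 0) {-r..0}, restrict (\<lambda>_. 0) {-r..0})"

lemma zero_history_in_Hc:
  assumes "open \<Omega>" "bounded \<Omega>"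
  shows "zero_history r \<in> Hc \<Omega> r"
proof -
  have cont: "cont_into X nX {-r..0} (restrict (\<lambda>_. 0) {-r..0})"
    if "0 \<in> X" "nX 0 = 0" for X and nX :: "'a l2 \<Rightarrow> real"
    unfolding cont_into_def
  proof (intro ballI conjI)
    fix t :: real assume t: "t \<in> {-r..0}"
    then show "restrict (\<lambda>_. 0) {-r..0} t \<in> X" using that by simp
    show "((\<lambda>s. nX (restrict (\<lambda>_. 0) {-r..0} s - restrict (\<lambda>_. 0) {-r..0} t)) \<longlongrightarrow> 0) (at t within {-r..0})"
      by (rule Lim_transform_eventually[OF tendsto_const]) (use t that in \<open>auto simp: eventually_at_filter\<close>)
  qed
  have "cont_into (V \<Omega>) (V_norm \<Omega>) {-r..0} (restrict (\<lambda>_. 0) {-r..0})"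
    by (rule cont) (simp_all add: zero_in_V assms V_norm_def Laplacian_0)
  moreover have "cont_into (L2 \<Omega>) norm {-r..0} (restrict (\<lambda>_. 0) {-r..0})"
    by (rule cont) (simp_all add: zero_in_L2)
  moreover have "(restrict (\<lambda>_. 0) {-r..0} has_vector_derivative restrict (\<lambda>_. 0::'a l2) {-r..0} \<theta>)
      (at \<theta> within {-r..0})" if "\<theta> \<in> {-r..0}" for \<theta>
    using that by (intro has_vector_derivative_transform[OF _ _ has_vector_derivative_const[of 0, THEN
      has_vector_derivative_eq_rhs]]) auto
  ultimately show ?thesis
    by (simp add: zero_history_def Hc_def C_hist_def)
qed

lemma Hc_norm_zero_history:
  assumes "open \<Omega>" "bounded \<Omega>" "0 \<le> r"
  shows "Hc_norm \<Omega> r (zero_history r) = 0"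
proof -
  have "sup_norm r nX (restrict (\<lambda>_. 0) {-r..0}) = 0" if "nX 0 = 0" for nX :: "'a l2 \<Rightarrow> real"
    unfolding sup_norm_def using assms(3) that by (subst SUP_cong[OF refl, of _ _ "\<lambda>_. 0"]) auto
  then show ?thesis
    using Laplacian_0[OF assms(1,2)] by (simp add: Hc_norm_def zero_history_def V_norm_def)
qed

section \<open>Decay of solutions and pullback absorption\<close>

lemma sup_norm_square_le:
  assumes "0 \<le> r" "\<And>\<theta>. \<theta> \<in> {-r..0} \<Longrightarrow> 0 \<le> nX (\<xi> \<theta>) \<and> (nX (\<xi> \<theta>))\<^sup>2 \<le> M"
  shows "(sup_norm r nX \<xi>)\<^sup>2 \<le> M"
proof -
  have le: "nX (\<xi> \<theta>) \<le> sqrt M" if "\<theta> \<in> {-r..0}" for \<theta>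
    using assms(2)[OF that] by (auto intro: real_le_rsqrt)
  \<comment> \<open>Squaring is monotone only on nonnegative numbers. Boundedness makes the real
    supremum dominate the value at \<open>0\<close>, which is nonnegative.\<close>
  have "bdd_above ((\<lambda>\<theta>. nX (\<xi> \<theta>)) ` {-r..0})"
    by (rule bdd_aboveI2[of _ _ "sqrt M"]) (rule le)
  then have "nX (\<xi> 0) \<le> sup_norm r nX \<xi>"
    unfolding sup_norm_def using assms(1) by (intro cSUP_upper) auto
  with assms have 0: "0 \<le> sup_norm r nX \<xi>" by (meson atLeastAtMost_iff neg_le_0_iff_le order.refl order.trans)
  have "sup_norm r nX \<xi> \<le> sqrt M"
    unfolding sup_norm_def using assms(1) le by (intro cSUP_least) auto
  then have "(sup_norm r nX \<xi>)\<^sup>2 \<le> (sqrt M)\<^sup>2" using 0 by (rule power_mono)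
  moreover have "0 \<le> M" using assms(1) assms(2)[of 0] by (auto intro: order.trans[OF zero_le_power2])
  ultimately show ?thesis by simp
qed

lemma Hc_norm_nonneg: "0 \<le> Hc_norm \<Omega> r \<phi>"
  by (simp add: Hc_norm_def)

lemma Hc_norm_square: "(Hc_norm \<Omega> r \<phi>)\<^sup>2 = (sup_norm r (V_norm \<Omega>) (fst \<phi>))\<^sup>2 + (sup_norm r norm (snd \<phi>))\<^sup>2"
  by (simp add: Hc_norm_def)

lemma set_integral_subset_le:
  fixes g :: "'a \<Rightarrow> real"
  assumes "set_integrable M B g" "A \<subseteq> B" "A \<in> sets M" "\<And>x. x \<in> B \<Longrightarrow> 0 \<le> g x"
  shows "(LINT x:A|M. g x) \<le> (LINT x:B|M. g x)"
proof -
  have "set_integrable M A g" using assms by (auto intro: set_integrable_subset)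
  then show ?thesis
    using assms unfolding set_lebesgue_integral_def set_integrable_def
    by (intro integral_mono) (auto simp: indicator_def)
qed

lemma set_integral_nonneg:
  fixes g :: "'a \<Rightarrow> real"
  assumes "\<And>x. x \<in> A \<Longrightarrow> 0 \<le> g x"
  shows "0 \<le> (LINT x:A|M. g x)"
  unfolding set_lebesgue_integral_def using assms
  by (intro Bochner_Integration.integral_nonneg) (auto simp: indicator_def)

lemma set_integral_exp_le:
  fixes \<alpha> :: real
  assumes "0 < \<alpha>" "a \<le> b"
  shows "(LINT s:{a..b}|lebesgue. exp (\<alpha> * s)) \<le> exp (\<alpha> * b) / \<alpha>"
proof -
  have "((\<lambda>s. exp (\<alpha> * s)) has_integral (exp (\<alpha> * b) / \<alpha> - exp (\<alpha> * a) / \<alpha>)) {a..b}"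
    by (rule fundamental_theorem_of_calculus[OF assms(2)])
      (use assms in \<open>auto intro!: derivative_eq_intros simp flip: has_real_derivative_iff_has_vector_derivative\<close>)
  moreover have "(LINT s:{a..b}|lebesgue. exp (\<alpha> * s)) = integral {a..b} (\<lambda>s. exp (\<alpha> * s))"
    by (intro set_lebesgue_integral_eq_integral absolutely_integrable_continuous_real continuous_intros)
  ultimately have "(LINT s:{a..b}|lebesgue. exp (\<alpha> * s)) = exp (\<alpha> * b) / \<alpha> - exp (\<alpha> * a) / \<alpha>"
    by (simp add: integral_unique)
  then show ?thesis using assms(1) by simp
qed

text \<open>No measurability of the energy is available. If \<open>exp ((\<alpha> + \<delta>) * s) * y s\<close> is not integrable, its
  integral is \<open>0\<close> by convention and the hypothesis already gives the bound.\<close>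

lemma gronwall_exp_forcing:
  fixes y g :: "real \<Rightarrow> real"
  assumes "\<tau> \<le> t" and pos: "0 < \<delta>" "0 < \<alpha>" "0 < C"
    and y0: "\<And>s. s \<in> {\<tau>..t} \<Longrightarrow> 0 \<le> y s" and g0: "\<And>s. 0 \<le> g s"
    and g: "set_integrable lebesgue {..t} (\<lambda>s. exp (\<alpha> * s) * g s)"
    and le: "\<And>s. s \<in> {\<tau>..t} \<Longrightarrow> y s * exp ((\<alpha> + \<delta>) * s) \<le> C * exp ((\<alpha> + \<delta>) * \<tau>) * N
        + \<delta> * (LINT \<sigma>:{\<tau>..s}|lebesgue. exp ((\<alpha> + \<delta>) * \<sigma>) * y \<sigma>)
        + C * (LINT \<sigma>:{\<tau>..s}|lebesgue. exp ((\<alpha> + \<delta>) * \<sigma>) * g \<sigma>)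
        + C * (LINT \<sigma>:{\<tau>..s}|lebesgue. exp ((\<alpha> + \<delta>) * \<sigma>))"
  shows "y t \<le> C * (exp (- \<alpha> * (t - \<tau>)) * N
        + exp (- \<alpha> * t) * (LINT s:{..t}|lebesgue. exp (\<alpha> * s) * g s) + 1 / \<alpha>)"
proof -
  let ?\<beta> = "\<alpha> + \<delta>"
  define z where "z s = exp (?\<beta> * s) * y s" for s
  define k where "k s = C * (exp (?\<beta> * s) * g s) + C * exp (?\<beta> * s)" for s
  define A where "A = C * exp (?\<beta> * \<tau>) * N"
  have gt: "set_integrable lebesgue {\<tau>..t} (\<lambda>s. exp (\<alpha> * s) * g s)"
    by (rule set_integrable_subset[OF g]) auto
  have et: "set_integrable lebesgue {\<tau>..t} (\<lambda>s. exp (c * s))" for c :: real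
    by (intro absolutely_integrable_continuous_real continuous_intros)
  have "set_integrable lebesgue {\<tau>..t} (\<lambda>s. exp (\<delta> * s) * (exp (\<alpha> * s) * g s))"
    by (intro set_integrable_mult_continuous[OF gt] continuous_intros)
  moreover have "exp (\<delta> * s) * (exp (\<alpha> * s) * g s) = exp (?\<beta> * s) * g s" for s
    by (simp add: distrib_right exp_add)
  ultimately have bt: "set_integrable lebesgue {\<tau>..t} (\<lambda>s. exp (?\<beta> * s) * g s)" by simp
  have kt: "set_integrable lebesgue {\<tau>..t} k"
    unfolding k_def by (intro set_integral_add set_integrable_mult_right bt et)
  have k0: "0 \<le> k s" for s using pos g0[of s] by (simp add: k_def)
  have kint: "(LINT \<sigma>:{\<tau>..s}|lebesgue. k \<sigma>) = C * (LINT \<sigma>:{\<tau>..s}|lebesgue. exp (?\<beta> * \<sigma>) * g \<sigma>)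
        + C * (LINT \<sigma>:{\<tau>..s}|lebesgue. exp (?\<beta> * \<sigma>))" if "s \<in> {\<tau>..t}" for s
  proof -
    have sub: "{\<tau>..s} \<subseteq> {\<tau>..t}" using that by auto
    have "set_integrable lebesgue {\<tau>..s} (\<lambda>\<sigma>. C * (exp (?\<beta> * \<sigma>) * g \<sigma>))"
      "set_integrable lebesgue {\<tau>..s} (\<lambda>\<sigma>. C * exp (?\<beta> * \<sigma>))"
      by (intro set_integrable_mult_right set_integrable_subset[OF bt _ sub] set_integrable_subset[OF et _ sub]; simp)+
    from set_integral_add(2)[OF this] show ?thesis unfolding k_def by simp
  qed
  have zle: "z s \<le> A + (LINT \<sigma>:{\<tau>..s}|lebesgue. k \<sigma>) + \<delta> * (LINT \<sigma>:{\<tau>..s}|lebesgue. z \<sigma>)"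
    if "s \<in> {\<tau>..t}" for s
    using le[OF that] kint[OF that] unfolding z_def A_def by (simp add: mult.commute)
  \<comment> \<open>The Gronwall kernel turns the weight with exponent
    \<open>\<alpha> + \<delta>\<close> into one with exponent \<alpha>, times a factor free of
    \<open>s\<close>.\<close>
  have dt: "exp (\<delta> * (t - s)) * k s = C * exp (\<delta> * t) * (exp (\<alpha> * s) * g s) + C * exp (\<delta> * t) * exp (\<alpha> * s)" for s
    unfolding k_def by (simp add: distrib_right distrib_left right_diff_distrib exp_add exp_diff)
  have dti: "set_integrable lebesgue {\<tau>..t} (\<lambda>s. exp (\<delta> * (t - s)) * k s)"
    by (intro set_integrable_mult_continuous[OF kt] continuous_intros)
  \<comment> \<open>At \<open>s = \<tau>\<close> all integrals are over a null set, and the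
    hypothesis reads \<open>0 \<le> z \<tau> \<le> A\<close>.\<close>
  have A0: "0 \<le> A"
  proof -
    have "(LINT s:{\<tau>..\<tau>}|lebesgue. q s) = 0" for q :: "real \<Rightarrow> real"
      unfolding set_lebesgue_integral_def
      by (rule integral_eq_zero_AE, rule AE_mp[OF AE_not_in[of "{\<tau>}"]]) auto
    then show ?thesis using zle[of \<tau>] y0[of \<tau>] \<open>\<tau> \<le> t\<close> by (simp add: z_def zero_le_mult_iff order.trans[rotated])
  qed
  have main: "z t \<le> exp (\<delta> * (t - \<tau>)) * A + (LINT s:{\<tau>..t}|lebesgue. exp (\<delta> * (t - s)) * k s)"
  proof (cases "set_integrable lebesgue {\<tau>..t} z")
    case True
    show ?thesis
      by (rule gronwall[OF \<open>\<tau> \<le> t\<close> less_imp_le[OF pos(1)] True kt])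
        (use y0 k0 zle in \<open>auto simp: z_def\<close>)
  next
    case False
    then have "(LINT \<sigma>:{\<tau>..t}|lebesgue. z \<sigma>) = 0"
      by (simp add: set_integrable_def set_lebesgue_integral_def not_integrable_integral_eq)
    then have "z t \<le> A + (LINT \<sigma>:{\<tau>..t}|lebesgue. k \<sigma>)" using zle[of t] \<open>\<tau> \<le> t\<close> by simp
    also have "\<dots> \<le> exp (\<delta> * (t - \<tau>)) * A + (LINT s:{\<tau>..t}|lebesgue. exp (\<delta> * (t - s)) * k s)"
    proof (rule add_mono)
      show "A \<le> exp (\<delta> * (t - \<tau>)) * A"
        using A0 pos \<open>\<tau> \<le> t\<close> by (simp add: mult_le_cancel_right1)
      show "(LINT \<sigma>:{\<tau>..t}|lebesgue. k \<sigma>) \<le> (LINT s:{\<tau>..t}|lebesgue. exp (\<delta> * (t - s)) * k s)"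
      proof (rule set_integral_mono[OF kt dti])
        fix s assume "s \<in> {\<tau>..t}"
        then have "1 * k s \<le> exp (\<delta> * (t - s)) * k s"
          using pos k0 by (intro mult_right_mono) auto
        then show "k s \<le> exp (\<delta> * (t - s)) * k s" by simp
      qed
    qed
    finally show ?thesis .
  qed
  have "(LINT s:{\<tau>..t}|lebesgue. exp (\<delta> * (t - s)) * k s)
      = C * exp (\<delta> * t) * (LINT s:{\<tau>..t}|lebesgue. exp (\<alpha> * s) * g s)
        + C * exp (\<delta> * t) * (LINT s:{\<tau>..t}|lebesgue. exp (\<alpha> * s))"
    unfolding dt using set_integral_add(2)[OF set_integrable_mult_right[OF gt] set_integrable_mult_right[OF et]]
    by simp
  \<comment> \<open>Extending the forcing integral over the whole past makes the bound on the
    forcing independent of \<tau>.\<close>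
  also have "\<dots> \<le> C * exp (\<delta> * t) * (LINT s:{..t}|lebesgue. exp (\<alpha> * s) * g s)
        + C * exp (\<delta> * t) * (exp (\<alpha> * t) / \<alpha>)"
    using pos \<open>\<tau> \<le> t\<close> g0
    by (intro add_mono mult_left_mono set_integral_exp_le set_integral_subset_le[OF g]) auto
  finally have "z t \<le> exp (\<delta> * (t - \<tau>)) * A + (C * exp (\<delta> * t) * (LINT s:{..t}|lebesgue. exp (\<alpha> * s) * g s)
        + C * exp (\<delta> * t) * (exp (\<alpha> * t) / \<alpha>))" (is "_ \<le> ?R")
    using main by simp
  then have "exp (- ?\<beta> * t) * z t \<le> exp (- ?\<beta> * t) * ?R" by (rule mult_left_mono) simp
  moreover have "exp (- ?\<beta> * t) * z t = y t"
  proof -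
    have "exp (- ?\<beta> * t) * exp (?\<beta> * t) = 1" by (simp add: algebra_simps flip: exp_add)
    then show ?thesis by (simp add: z_def flip: mult.assoc)
  qed
  moreover have "exp (- ?\<beta> * t) * ?R = C * (exp (- \<alpha> * (t - \<tau>)) * N
        + exp (- \<alpha> * t) * (LINT s:{..t}|lebesgue. exp (\<alpha> * s) * g s) + 1 / \<alpha>)"
    unfolding A_def
    by (simp add: exp_minus exp_add exp_diff left_diff_distrib right_diff_distrib distrib_right field_simps)
  ultimately show ?thesis by (simp only:)
qed


text \<open>The coercivity constant \<open>C5\<close> is used twice: it makes the energy
  nonnegative, so that Gronwall applies, and it converts the energy bound back into norms. The
  constant is chosen before all times, data and solutions.\<close>

lemma solution_decay:
  assumes ep: "energy_parameters \<Omega> lam r f G h \<epsilon> K0"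
    and dc: "delay_constant \<Omega> lam r f G h \<epsilon> K0 \<beta> \<delta>G"
    and \<alpha>: "\<alpha> = \<beta> - \<delta>G" "0 < \<alpha>"
    and h: "\<And>t. set_integrable lebesgue {..t} (\<lambda>s. exp (\<alpha> * s) * (norm (h s))\<^sup>2)"
  shows "\<exists>C>0. \<forall>\<tau> T u v \<phi> t. \<phi> \<in> Hc \<Omega> r \<longrightarrow> \<tau> < T \<longrightarrow>
      weak_solution \<Omega> lam r f G h \<tau> T \<phi> u v \<longrightarrow> t \<in> {\<tau>..T} \<longrightarrow>
      (norm (v t))\<^sup>2 + (V_norm \<Omega> (u t))\<^sup>2 \<le> C * (exp (- \<alpha> * (t - \<tau>)) * (1 + (Hc_norm \<Omega> r \<phi>)\<^sup>2)
        + exp (- \<alpha> * t) * (LINT s:{..t}|lebesgue. exp (\<alpha> * s) * (norm (h s))\<^sup>2) + 1)"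
proof -
  obtain C5 where C5: "0 < C5" "\<And>\<tau> T u v \<phi> t. \<phi> \<in> Hc \<Omega> r \<Longrightarrow> \<tau> < T \<Longrightarrow>
      weak_solution \<Omega> lam r f G h \<tau> T \<phi> u v \<Longrightarrow> t \<in> {\<tau>..T} \<Longrightarrow>
      C5 * ((norm (v t))\<^sup>2 + (norm (Laplacian \<Omega> (u t)))\<^sup>2) \<le> energy \<Omega> lam f \<epsilon> K0 u v t"
    using ep unfolding energy_parameters_def by blast
  have \<delta>: "0 < \<delta>G" using dc by (simp add: delay_constant_def)
  obtain C where C: "0 < C" and ineq: "\<And>\<tau> T u v \<phi> t. \<phi> \<in> Hc \<Omega> r \<Longrightarrow> \<tau> < T \<Longrightarrow>
      weak_solution \<Omega> lam r f G h \<tau> T \<phi> u v \<Longrightarrow> t \<in> {\<tau>..T} \<Longrightarrow>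
      energy \<Omega> lam f \<epsilon> K0 u v t * exp (\<beta> * t)
             \<le> C * exp (\<beta> * \<tau>) * (1 + (sup_norm r (V_norm \<Omega>) (fst \<phi>))\<^sup>2
                                      + (sup_norm r norm (snd \<phi>))\<^sup>2)
               + \<delta>G * (LINT s:{\<tau>..t}|lebesgue. exp (\<beta> * s) * energy \<Omega> lam f \<epsilon> K0 u v s)
               + C * (LINT s:{\<tau>..t}|lebesgue. exp (\<beta> * s) * (norm (h s))\<^sup>2)
               + C * (LINT s:{\<tau>..t}|lebesgue. exp (\<beta> * s))"
    using dc unfolding delay_constant_def by blast
  have \<beta>: "\<beta> = \<alpha> + \<delta>G" using \<alpha> by simp
  \<comment> \<open>The division by \<open>C5\<close> is coercivity; the factor
    \<open>1 + 1 / \<alpha>\<close> absorbs the term \<open>1 / \<alpha>\<close> left by the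
    constant forcing.\<close>
  define C' where "C' = C / C5 * (1 + 1 / \<alpha>)"
  show ?thesis
  proof (intro exI[of _ C'] conjI allI impI)
    show "0 < C'" unfolding C'_def using C C5(1) \<alpha>(2)
      by (intro mult_pos_pos divide_pos_pos add_pos_pos) auto
  next
    fix \<tau> T u v \<phi> t
    assume sol: "\<phi> \<in> Hc \<Omega> r" "\<tau> < T" "weak_solution \<Omega> lam r f G h \<tau> T \<phi> u v" and t: "t \<in> {\<tau>..T}"
    let ?E = "energy \<Omega> lam f \<epsilon> K0 u v"
    let ?X = "exp (- \<alpha> * (t - \<tau>)) * (1 + (Hc_norm \<Omega> r \<phi>)\<^sup>2)"
    let ?Y = "exp (- \<alpha> * t) * (LINT s:{..t}|lebesgue. exp (\<alpha> * s) * (norm (h s))\<^sup>2)"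
    have "?E t \<le> C * (?X + ?Y + 1 / \<alpha>)"
    proof (rule gronwall_exp_forcing[OF _ \<delta> \<alpha>(2) C])
      fix s assume s: "s \<in> {\<tau>..t}"
      with t have sT: "s \<in> {\<tau>..T}" by auto
      show "0 \<le> ?E s"
        by (rule order.trans[OF _ C5(2)[OF sol sT]]) (use C5(1) in simp)
      show "?E s * exp ((\<alpha> + \<delta>G) * s) \<le> C * exp ((\<alpha> + \<delta>G) * \<tau>) * (1 + (Hc_norm \<Omega> r \<phi>)\<^sup>2)
        + \<delta>G * (LINT \<sigma>:{\<tau>..s}|lebesgue. exp ((\<alpha> + \<delta>G) * \<sigma>) * ?E \<sigma>)
        + C * (LINT \<sigma>:{\<tau>..s}|lebesgue. exp ((\<alpha> + \<delta>G) * \<sigma>) * (norm (h \<sigma>))\<^sup>2)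
        + C * (LINT \<sigma>:{\<tau>..s}|lebesgue. exp ((\<alpha> + \<delta>G) * \<sigma>))"
        using ineq[OF sol sT] unfolding \<beta> Hc_norm_square by (simp only: add.assoc)
    qed (use t h in auto)
    also have "\<dots> \<le> C * ((1 + 1 / \<alpha>) * (?X + ?Y + 1))"
    proof -
      have "0 \<le> ?X" "0 \<le> ?Y" by (auto intro!: mult_nonneg_nonneg set_integral_nonneg)
      then have "0 \<le> 1 / \<alpha> * (?X + ?Y)" using \<alpha> by (intro mult_nonneg_nonneg) auto
      then have "?X + ?Y + 1 / \<alpha> \<le> (1 + 1 / \<alpha>) * (?X + ?Y + 1)"
        by (simp only: distrib_right distrib_left mult_1_left mult_1_right)
      then show ?thesis using C by (intro mult_left_mono) auto
    qed
    finally have "C5 * ((norm (v t))\<^sup>2 + (V_norm \<Omega> (u t))\<^sup>2) \<le> C * ((1 + 1 / \<alpha>) * (?X + ?Y + 1))"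
      using C5(2)[OF sol t] unfolding V_norm_def by linarith
    then show "(norm (v t))\<^sup>2 + (V_norm \<Omega> (u t))\<^sup>2 \<le> C' * (?X + ?Y + 1)"
      using C5(1) by (simp only: C'_def pos_le_divide_eq[symmetric] mult.commute[of C5] times_divide_eq_left mult.assoc)
  qed
qed

text \<open>On the window the exponentials are largest at \<open>t - r\<close>, while the forcing
  integral is largest at \<open>t\<close>; combining both gives one bound \<open>M\<close>. The two
  suprema may be reached at different times, so each is bounded by \<open>M\<close> separately,
  hence the factor \<open>2\<close>.\<close>

lemma history_decay:
  assumes "0 \<le> r" "0 \<le> \<alpha>" "0 \<le> C" "0 \<le> N" "t - r \<in> {\<tau>..T}" "t \<le> T"
    and h: "set_integrable lebesgue {..t} (\<lambda>s. exp (\<alpha> * s) * g s)" and g0: "\<And>s. 0 \<le> g s"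
    and le: "\<And>s. s \<in> {\<tau>..T} \<Longrightarrow> (norm (v s))\<^sup>2 + (V_norm \<Omega> (u s))\<^sup>2 \<le> C * (exp (- \<alpha> * (s - \<tau>)) * N
        + exp (- \<alpha> * s) * (LINT s:{..s}|lebesgue. exp (\<alpha> * s) * g s) + 1)"
  shows "(Hc_norm \<Omega> r (history r u t, history r v t))\<^sup>2 \<le> 2 * C * (exp (- \<alpha> * (t - r - \<tau>)) * N
        + exp (- \<alpha> * (t - r)) * (LINT s:{..t}|lebesgue. exp (\<alpha> * s) * g s) + 1)"
proof -
  define I where "I t = (LINT s:{..t}|lebesgue. exp (\<alpha> * s) * g s)" for t
  define M where "M = C * (exp (- \<alpha> * (t - r - \<tau>)) * N + exp (- \<alpha> * (t - r)) * I t + 1)"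
  have bound: "(norm (v (t + \<theta>)))\<^sup>2 + (V_norm \<Omega> (u (t + \<theta>)))\<^sup>2 \<le> M" if \<theta>: "\<theta> \<in> {-r..0}" for \<theta>
  proof -
    have "I (t + \<theta>) \<le> I t" unfolding I_def
      by (rule set_integral_subset_le[OF h]) (use \<theta> g0 in auto)
    moreover have "0 \<le> I (t + \<theta>)" unfolding I_def using g0 by (intro set_integral_nonneg) auto
    moreover have "\<alpha> * (t - r) \<le> \<alpha> * (t + \<theta>)" using \<theta> assms(2) by (intro mult_left_mono) auto
    ultimately have "C * (exp (- \<alpha> * (t + \<theta> - \<tau>)) * N + exp (- \<alpha> * (t + \<theta>)) * I (t + \<theta>) + 1) \<le> M"
      unfolding M_def using assms(3,4)
      by (intro mult_left_mono add_mono mult_mono order.refl) (auto simp: algebra_simps)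
    moreover have "t + \<theta> \<in> {\<tau>..T}" using \<theta> assms(5,6) by auto
    ultimately show ?thesis using le[of "t + \<theta>"] unfolding I_def by linarith
  qed
  have "(norm (v (t + \<theta>)))\<^sup>2 \<le> M" "(V_norm \<Omega> (u (t + \<theta>)))\<^sup>2 \<le> M" if "\<theta> \<in> {-r..0}" for \<theta>
    using bound[OF that] zero_le_power2[of "norm (v (t + \<theta>))"] zero_le_power2[of "V_norm \<Omega> (u (t + \<theta>))"]
    by linarith+
  then have "(sup_norm r (V_norm \<Omega>) (history r u t))\<^sup>2 \<le> M" "(sup_norm r norm (history r v t))\<^sup>2 \<le> M"
    using assms(1) by (auto intro!: sup_norm_square_le simp: history_def V_norm_def)
  then show ?thesis unfolding Hc_norm_square M_def I_def by simp
qed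

section \<open>Limits at minus infinity and tempered families\<close>

lemma tendsto_exp_mult_at_bot: "0 < \<alpha> \<Longrightarrow> ((\<lambda>\<tau>::real. exp (\<alpha> * \<tau>)) \<longlongrightarrow> 0) at_bot"
  by (rule filterlim_compose[OF exp_at_bot])
    (rule filterlim_tendsto_pos_mult_at_bot[OF tendsto_const _ filterlim_ident])

lemma tendsto_tail_integral_at_bot:
  fixes g :: "real \<Rightarrow> real"
  assumes g: "set_integrable lebesgue {..b} g"
  shows "((\<lambda>\<tau>. LINT s:{..\<tau>}|lebesgue. g s) \<longlongrightarrow> 0) at_bot"
proof -
  have "((\<lambda>\<tau>. (LINT s:{..b}|lebesgue. g s) - (LINT s:{\<tau>..b}|lebesgue. g s)) \<longlongrightarrow>
      (LINT s:{..b}|lebesgue. g s) - (LINT s:{..b}|lebesgue. g s)) at_bot"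
    by (intro tendsto_diff tendsto_const tendsto_set_lebesgue_integral_at_bot g) auto
  moreover have "(LINT s:{..b}|lebesgue. g s) - (LINT s:{\<tau>..b}|lebesgue. g s) = (LINT s:{..\<tau>}|lebesgue. g s)"
    if "\<tau> \<le> b" for \<tau>
  proof -
    have int: "set_integrable lebesgue {..\<tau>} g" "set_integrable lebesgue {..<\<tau>} g" "set_integrable lebesgue {\<tau>..b} g"
      using that by (auto intro!: set_integrable_subset[OF g])
    have "{..b} = {..<\<tau>} \<union> {\<tau>..b}" "{..<\<tau>} \<inter> {\<tau>..b} = {}" using that by auto
    then have "(LINT s:{..b}|lebesgue. g s) = (LINT s:{..<\<tau>}|lebesgue. g s) + (LINT s:{\<tau>..b}|lebesgue. g s)"
      using set_integral_Un[OF _ int(2,3)] by metis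
    moreover have "(LINT s:{..<\<tau>}|lebesgue. g s) = (LINT s:{..\<tau>}|lebesgue. g s)"
      using int AE_not_in[of "{\<tau>}" lebesgue]
      unfolding set_lebesgue_integral_def set_integrable_def
      by (intro integral_cong_AE) (auto elim!: AE_mp simp: indicator_def)
    ultimately show ?thesis by simp
  qed
  ultimately show ?thesis
    by (rule_tac Lim_transform_eventually) (auto simp: eventually_at_bot_linorder)
qed

text \<open>The supremum in temperedness gives smallness uniformly over \<open>D \<tau>\<close>, so
  one threshold serves all data. The summand \<open>1\<close> is the constant next to the squared
  norms in the delay inequality; each summand receives half of \<open>e\<close>.\<close>

lemma tempered_imp_decay:
  assumes "D \<in> tempered \<alpha> X nX" "0 < \<alpha>" "0 < e"
  shows "\<forall>\<^sub>F \<tau> in at_bot. \<forall>\<xi>\<in>D \<tau>. exp (\<alpha> * \<tau>) * (1 + (nX \<xi>)\<^sup>2) \<le> e"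
proof -
  have lim: "((\<lambda>\<tau>. ennreal (exp (\<alpha> * \<tau>)) * (SUP \<xi>\<in>D \<tau>. ennreal ((nX \<xi>)\<^sup>2))) \<longlongrightarrow> 0) at_bot"
    using assms(1) by (simp add: tempered_def)
  have "\<forall>\<^sub>F \<tau> in at_bot. ennreal (exp (\<alpha> * \<tau>)) * (SUP \<xi>\<in>D \<tau>. ennreal ((nX \<xi>)\<^sup>2)) < ennreal (e / 2)"
    by (rule order_tendstoD(2)[OF lim]) (use assms(3) in simp)
  moreover have "\<forall>\<^sub>F \<tau> in at_bot. exp (\<alpha> * \<tau>) < e / 2"
    by (rule order_tendstoD(2)[OF tendsto_exp_mult_at_bot[OF assms(2)]]) (use assms(3) in simp)
  ultimately show ?thesis
  proof eventually_elim
    case (elim \<tau>)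
    show ?case
    proof
      fix \<xi> assume "\<xi> \<in> D \<tau>"
      then have "ennreal (exp (\<alpha> * \<tau>)) * ennreal ((nX \<xi>)\<^sup>2)
          \<le> ennreal (exp (\<alpha> * \<tau>)) * (SUP \<xi>\<in>D \<tau>. ennreal ((nX \<xi>)\<^sup>2))"
        by (intro mult_left_mono SUP_upper) auto
      with elim(1) have "ennreal (exp (\<alpha> * \<tau>) * (nX \<xi>)\<^sup>2) < ennreal (e / 2)"
        by (simp add: ennreal_mult order.strict_trans1)
      then have "exp (\<alpha> * \<tau>) * (nX \<xi>)\<^sup>2 < e / 2"
        using assms(3) by (subst (asm) ennreal_less_iff) auto
      with elim(2) show "exp (\<alpha> * \<tau>) * (1 + (nX \<xi>)\<^sup>2) \<le> e" by (simp add: distrib_left)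
    qed
  qed
qed

lemma temperedI:
  assumes "\<And>t. D t \<noteq> {}" "\<And>t. D t \<subseteq> X" "\<And>t \<xi>. \<xi> \<in> D t \<Longrightarrow> (nX \<xi>)\<^sup>2 \<le> R t"
    and "\<And>t. 0 \<le> R t" "((\<lambda>t. exp (\<alpha> * t) * R t) \<longlongrightarrow> 0) at_bot"
  shows "D \<in> tempered \<alpha> X nX"
proof -
  have "((\<lambda>t. ennreal (exp (\<alpha> * t)) * (SUP \<xi>\<in>D t. ennreal ((nX \<xi>)\<^sup>2))) \<longlongrightarrow> 0) at_bot"
  proof (rule tendsto_sandwich[OF _ _ tendsto_const])
    show "((\<lambda>t. ennreal (exp (\<alpha> * t) * R t)) \<longlongrightarrow> 0) at_bot"
      using tendsto_ennrealI[OF assms(5)] by simp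
    have "ennreal (exp (\<alpha> * t)) * (SUP \<xi>\<in>D t. ennreal ((nX \<xi>)\<^sup>2)) \<le> ennreal (exp (\<alpha> * t)) * ennreal (R t)" for t
      using assms(3) by (intro mult_left_mono SUP_least ennreal_leI) auto
    then show "\<forall>\<^sub>F t in at_bot. ennreal (exp (\<alpha> * t)) * (SUP \<xi>\<in>D t. ennreal ((nX \<xi>)\<^sup>2)) \<le> ennreal (exp (\<alpha> * t) * R t)"
      using assms(4) by (simp add: ennreal_mult)
  qed simp
  then show ?thesis using assms(1,2) by (simp add: tempered_def)
qed

theorem corollary4p3:
  fixes \<Omega> :: "(real ^ 'n) set"
    and lam r :: real
    and f :: "real \<Rightarrow> real"
    and G :: "real \<Rightarrow> (real \<Rightarrow> (real ^ 'n) l2) \<Rightarrow> (real ^ 'n) l2"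
    and h :: "real \<Rightarrow> (real ^ 'n) l2"
    and \<epsilon> K0 \<beta> \<delta>G \<alpha> :: real
  assumes "bounded_smooth_domain \<Omega>" and "0 < lam" and "0 < r"
    and "f_hypotheses \<Omega> lam f"
    and "G_hypotheses \<Omega> r G"
    and "L2_loc_into (L2 \<Omega>) norm h"
    and "well_posed \<Omega> lam r f G h"
    and "energy_parameters \<Omega> lam r f G h \<epsilon> K0"
    and "dissipation_rate \<Omega> lam r f G h \<epsilon> K0 \<beta>"
    and "delay_constant \<Omega> lam r f G h \<epsilon> K0 \<beta> \<delta>G"
    and "\<alpha> = \<beta> - \<delta>G" and "0 < \<alpha>"
    and "\<And>t. set_integrable lebesgue {..t} (\<lambda>s. exp (\<alpha> * s) * (norm (h s))\<^sup>2)"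
  shows "\<exists>C>0.
    let \<rho> = (\<lambda>t. sqrt (C * (1 + exp (- \<alpha> * (t - r)) *
                 (LINT s:{..t}|lebesgue. exp (\<alpha> * s) * (norm (h s))\<^sup>2))));
        D0 = (\<lambda>t. {\<xi> \<in> Hc \<Omega> r. Hc_norm \<Omega> r \<xi> \<le> \<rho> t});
        D_alpha = tempered \<alpha> (Hc \<Omega> r) (Hc_norm \<Omega> r)
    in pullback_absorbing (process \<Omega> lam r f G h) D_alpha D0 \<and> D0 \<in> D_alpha"
proof -
  let ?U = "process \<Omega> lam r f G h"
  define I where "I t = (LINT s:{..t}|lebesgue. exp (\<alpha> * s) * (norm (h s))\<^sup>2)" for t
  have I0: "0 \<le> I t" for t unfolding I_def by (intro set_integral_nonneg) auto
  have \<Omega>: "open \<Omega>" "bounded \<Omega>" using assms(1) by (auto simp: bounded_smooth_domain_def)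
  have r: "0 \<le> r" "0 \<le> \<alpha>" using assms(3,12) by auto
  obtain C where C: "0 < C" and decay: "\<forall>\<tau> T u v \<phi> t. \<phi> \<in> Hc \<Omega> r \<longrightarrow> \<tau> < T \<longrightarrow>
      weak_solution \<Omega> lam r f G h \<tau> T \<phi> u v \<longrightarrow> t \<in> {\<tau>..T} \<longrightarrow>
      (norm (v t))\<^sup>2 + (V_norm \<Omega> (u t))\<^sup>2 \<le> C * (exp (- \<alpha> * (t - \<tau>)) * (1 + (Hc_norm \<Omega> r \<phi>)\<^sup>2)
        + exp (- \<alpha> * t) * (LINT s:{..t}|lebesgue. exp (\<alpha> * s) * (norm (h s))\<^sup>2) + 1)"
    using solution_decay[OF assms(8,10,11,12,13)] by (elim exE conjE)
  \<comment> \<open>The window estimate gives \<open>2 * C\<close>. Once the datum's share is at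
    most \<open>1\<close>, it joins the constant \<open>1\<close> already there, and this second
    doubling is applied to the whole bracket.\<close>
  define R where "R t = 4 * C * (1 + exp (- \<alpha> * (t - r)) * I t)" for t
  have R0: "0 \<le> R t" for t unfolding R_def using C I0[of t] by auto
  define D0 where "D0 t = {\<xi> \<in> Hc \<Omega> r. Hc_norm \<Omega> r \<xi> \<le> sqrt (R t)}" for t
  have absorb: "?U t \<tau> \<phi> \<in> D0 t"
    if \<phi>: "\<phi> \<in> Hc \<Omega> r" and \<tau>: "\<tau> \<le> t - r"
      and small: "exp (\<alpha> * \<tau>) * (1 + (Hc_norm \<Omega> r \<phi>)\<^sup>2) \<le> exp (\<alpha> * (t - r))" for t \<tau> \<phi>
  proof -
    \<comment> \<open>Any final time beyond \<open>t\<close> would do, since \<open>process\<close>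
      asks for one strictly later; \<open>t + 1\<close> also covers the whole window.\<close>
    have t: "\<tau> \<le> t" "\<tau> < t + 1" using \<tau> r by auto
    then obtain u v where sol: "weak_solution \<Omega> lam r f G h \<tau> (t + 1) \<phi> u v"
      and hist: "\<forall>s\<in>{\<tau>..t + 1}. (history r u s, history r v s) \<in> Hc \<Omega> r"
      using assms(7) \<phi> unfolding well_posed_def by meson
    have eq: "?U t \<tau> \<phi> = (history r u t, history r v t)"
      by (rule process_eq[OF assms(7) \<phi> t(1) sol]) simp
    have "(Hc_norm \<Omega> r (history r u t, history r v t))\<^sup>2
        \<le> 2 * C * (exp (- \<alpha> * (t - r - \<tau>)) * (1 + (Hc_norm \<Omega> r \<phi>)\<^sup>2)
        + exp (- \<alpha> * (t - r)) * (LINT s:{..t}|lebesgue. exp (\<alpha> * s) * (norm (h s))\<^sup>2) + 1)"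
      by (rule history_decay[OF r, where T = "t + 1" and g = "\<lambda>s. (norm (h s))\<^sup>2"])
        (use C \<tau> r assms(13) decay[rule_format, OF \<phi> t(2) sol] in auto)
    also have "\<dots> \<le> 2 * C * (1 + exp (- \<alpha> * (t - r)) * I t + 1)"
    proof -
      have "exp (- \<alpha> * (t - r)) * (exp (\<alpha> * \<tau>) * (1 + (Hc_norm \<Omega> r \<phi>)\<^sup>2))
          \<le> exp (- \<alpha> * (t - r)) * exp (\<alpha> * (t - r))"
        using small by (rule mult_left_mono) simp
      then have "exp (- \<alpha> * (t - r - \<tau>)) * (1 + (Hc_norm \<Omega> r \<phi>)\<^sup>2) \<le> 1"
        unfolding mult.assoc[symmetric] exp_add[symmetric] by (simp add: algebra_simps)
      then show ?thesis using C unfolding I_def by (intro mult_left_mono add_mono order.refl) auto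
    qed
    also have "\<dots> \<le> R t"
    proof -
      have "0 \<le> 2 * C * (exp (- \<alpha> * (t - r)) * I t)"
        using C I0[of t] by (intro mult_nonneg_nonneg) auto
      then show ?thesis unfolding R_def by (simp add: distrib_left)
    qed
    finally have "Hc_norm \<Omega> r (?U t \<tau> \<phi>) \<le> sqrt (R t)"
      unfolding eq by (rule real_le_rsqrt)
    then show ?thesis using hist t by (simp add: D0_def eq)
  qed
  have "pullback_absorbing ?U (tempered \<alpha> (Hc \<Omega> r) (Hc_norm \<Omega> r)) D0"
    unfolding pullback_absorbing_def
  proof (intro allI ballI)
    fix t D assume D: "D \<in> tempered \<alpha> (Hc \<Omega> r) (Hc_norm \<Omega> r)"
    then have sub: "D \<tau> \<subseteq> Hc \<Omega> r" for \<tau> by (simp add: tempered_def)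
    obtain N where N: "\<And>\<tau> \<xi>. \<tau> \<le> N \<Longrightarrow> \<xi> \<in> D \<tau> \<Longrightarrow>
        exp (\<alpha> * \<tau>) * (1 + (Hc_norm \<Omega> r \<xi>)\<^sup>2) \<le> exp (\<alpha> * (t - r))"
      using tempered_imp_decay[OF D assms(12), of "exp (\<alpha> * (t - r))"]
      unfolding eventually_at_bot_linorder by auto
    show "\<exists>\<tau>0\<le>t. \<forall>\<tau>\<le>\<tau>0. ?U t \<tau> ` D \<tau> \<subseteq> D0 t"
    \<comment> \<open>Staying below \<open>N\<close> makes the datum small; staying below
      \<open>t - r\<close> puts the whole window after the initial time, where the decay estimate
      holds.\<close>
    proof (intro exI[of _ "min N (t - r)"] conjI allI impI image_subsetI)
      show "min N (t - r) \<le> t" using r by simp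
      fix \<tau> \<xi> assume "\<tau> \<le> min N (t - r)" "\<xi> \<in> D \<tau>"
      then show "?U t \<tau> \<xi> \<in> D0 t" using sub N by (intro absorb) auto
    qed
  qed
  moreover have "D0 \<in> tempered \<alpha> (Hc \<Omega> r) (Hc_norm \<Omega> r)"
  proof (rule temperedI[of _ _ _ R])
    have "zero_history r \<in> D0 t" for t
      using zero_history_in_Hc[OF \<Omega>] Hc_norm_zero_history[OF \<Omega> r(1)] R0 by (simp add: D0_def)
    then show "D0 t \<noteq> {}" for t by blast
    show "D0 t \<subseteq> Hc \<Omega> r" for t by (auto simp: D0_def)
    show "(Hc_norm \<Omega> r \<xi>)\<^sup>2 \<le> R t" if "\<xi> \<in> D0 t" for \<xi> t
      using power_mono[OF _ Hc_norm_nonneg, of \<Omega> r \<xi> "sqrt (R t)" 2] that R0[of t] by (simp add: D0_def)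
    show "0 \<le> R t" for t by (rule R0)
    have "((\<lambda>t. 4 * C * (exp (\<alpha> * t) + exp (\<alpha> * r) * I t)) \<longlongrightarrow> 4 * C * (0 + exp (\<alpha> * r) * 0)) at_bot"
      unfolding I_def
      by (intro tendsto_mult tendsto_add tendsto_const tendsto_exp_mult_at_bot assms(12)
          tendsto_tail_integral_at_bot[OF assms(13)])
    \<comment> \<open>The exponentials multiply to the constant \<open>exp (\<alpha> * r)\<close>,
      so only a vanishing exponential and the tail \<open>I t\<close> remain.\<close>
    moreover have "exp (\<alpha> * t) * R t = 4 * C * (exp (\<alpha> * t) + exp (\<alpha> * r) * I t)" for t
    proof -
      have "exp (\<alpha> * t) * exp (- \<alpha> * (t - r)) = exp (\<alpha> * r)"
        unfolding exp_add[symmetric] by (simp add: algebra_simps)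
      moreover have "a * (4 * C * (1 + b * I t)) = 4 * C * (a + a * b * I t)" for a b
        by (simp add: algebra_simps)
      ultimately show ?thesis unfolding R_def by (simp only:)
    qed
    ultimately show "((\<lambda>t. exp (\<alpha> * t) * R t) \<longlongrightarrow> 0) at_bot" by simp
  qed
  ultimately show ?thesis
    unfolding D0_def[abs_def] R_def I_def Let_def using C by (intro exI[of _ "4 * C"]) auto
qed

end
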